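(* For any $0\le k\le n$ and any $x_k\in E_k$, $$\mathbb{E}\big(\widehat v_k(x_k)\big)\ \ge\ v_k(x_k).$$
   Context: Setting. Fix a horizon $n\ge1$ and measurable spaces $(E_k,\mathcal{E}_k)_{0\le k\le n}$. Let $X_0,\dots,X_n$ be a Markov chain with initial law $\eta_0$ on $E_0$ and Markov transitions $M_k(x_{k-1},dx_k)$ from $E_{k-1}$ to $E_k$, $1\le k\le n$. Assume there are measures $\lambda_k$ on $E_k$ and (jointly measurable) functions $H_k:E_{k-1}\times E_k\to(0,\infty)$ with $M_k(x_{k-1},dx_k)=H_k(x_{k-1},x_k)\lambda_k(dx_k)$. Let $f_k:E_k\to[0,\infty)$ be measurable and $G_k:E_k\to[0,\infty)$ be bounded measurable. Snell envelope. $v_n=f_n$ and, for $0\le k<n$, $v_k(x_k)=f_k(x_k)\vee\big[G_k(x_k)\int M_{k+1}(x_k,dx_{k+1})v_{k+1}(x_{k+1})\big]$ ($\vee$ is the maximum); the $v_k$ are assumed finite everywhere. Particle system. Fix $N\ge1$ and a real $\epsilon\ge 0$ with $\epsilon G_k\in[0,1]$ for all $k$. The particle system is a Markov chain $\xi_k=(\xi_k^i)_{1\le i\le N}\in E_k^N$, with empirical measures $\eta_k^N=\frac1N\sum_{i=1}^N\delta_{\xi_k^i}$. The $\xi_0^i$ are i.i.d. with law $\eta_0$. Given $\xi_0,\dots,\xi_k$, the $\xi_{k+1}^i$, $1\le i\le N$, are conditionally independent, $\xi_{k+1}^i$ having law $(S_{k,\eta_k^N}M_{k+1})(\xi_k^i,\cdot)$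 where $$S_{k,\eta}(x,dx')=\epsilon G_k(x)\delta_x(dx')+(1-\epsilon G_k(x))\frac{G_k(x')}{\eta(G_k)}\eta(dx').$$ The particle model is assumed well defined up to time $n$, i.e. $\eta_k^N(G_k)>0$ almost surely for $0\le k<n$. Approximation. $\widehat v_n=f_n$ and, for $0\le k<n$ and $x_k\in E_k$, $$\widehat v_k(x_k)=f_k(x_k)\vee\int\eta_{k+1}^N(dx_{k+1})\,\frac{G_k(x_k)H_{k+1}(x_k,x_{k+1})\,\eta_k^N(G_k)}{\eta_k^N(G_kH_{k+1}(\cdot,x_{k+1}))}\,\widehat v_{k+1}(x_{k+1}).$$ The expectation $\mathbb{E}$ is over the particle system, and takes values in $[0,\infty]$. *)

theory Defs
  imports "HOL-Probability.Probability"
begin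

text \<open>\<open>(1/N) \<Sum>\<^sub>i \<delta>\<^bsub>x i\<^esub>\<close>, as the image of the uniform distribution on the index set.\<close>

definition empirical_measure :: "nat \<Rightarrow> 'a measure \<Rightarrow> (nat \<Rightarrow> 'a) \<Rightarrow> 'a measure" where
  "empirical_measure N E x = distr (uniform_count_measure {1..N}) E x"

lemma sets_empirical_measure [simp, measurable_cong]: "sets (empirical_measure N E x) = sets E"
  and space_empirical_measure [simp]: "space (empirical_measure N E x) = space E"
  by (simp_all add: empirical_measure_def)

lemma nn_integral_empirical_measure:
  assumes "\<And>i. i \<in> {1..N} \<Longrightarrow> x i \<in> space E" and "g \<in> borel_measurable E"
  shows "(\<integral>\<^sup>+ y. g y \<partial>empirical_measure N E x) = (\<Sum>i=1..N. g (x i)) / of_nat N"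
proof -
  have x: "x \<in> uniform_count_measure {1..N} \<rightarrow>\<^sub>M E"
    using assms(1) by (auto simp: measurable_def sets_uniform_count_measure space_uniform_count_measure)
  have g: "g \<in> borel_measurable (distr (uniform_count_measure {1..N}) E x)"
    using assms(2) by simp
  have "(\<integral>\<^sup>+ y. g y \<partial>empirical_measure N E x)
      = (\<Sum>i=1..N. ennreal (1 / real N) * g (x i))"
    unfolding empirical_measure_def
    by (subst nn_integral_distr[OF x g])
       (simp add: uniform_count_measure_def nn_integral_point_measure_finite)
  also have "\<dots> = (\<Sum>i=1..N. g (x i)) / of_nat N"
  proof (cases "N = 0")
    case False
    then have "ennreal (1 / real N) = inverse (of_nat N)"
      by (simp add: ennreal_of_nat_eq_real_of_nat inverse_ennreal inverse_eq_divide)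
    then show ?thesis
      by (simp add: sum_distrib_left[symmetric] divide_ennreal_def mult.commute)
  qed simp
  finally show ?thesis .
qed

lemma emeasure_empirical_measure:
  assumes "\<And>i. i \<in> {1..N} \<Longrightarrow> x i \<in> space E" and "A \<in> sets E"
  shows "emeasure (empirical_measure N E x) A = (\<Sum>i=1..N. indicator A (x i)) / of_nat N"
  using nn_integral_empirical_measure[where g = "indicator A", OF assms(1)] assms(2) by simp

text \<open>The kernel \<open>S\<^bsub>k,\<eta>\<^esub>(x, \<sqdot>)\<close>, for \<open>G = G\<^sub>k\<close>.\<close>

definition selection_kernel :: "real \<Rightarrow> ('a \<Rightarrow> real) \<Rightarrow> 'a measure \<Rightarrow> 'a \<Rightarrow> 'a measure" where
  "selection_kernel \<epsilon> G \<eta> x = measure_of (space \<eta>) (sets \<eta>)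
     (\<lambda>A. ennreal (\<epsilon> * G x) * emeasure (return \<eta> x) A
        + ennreal (1 - \<epsilon> * G x)
          * emeasure (density \<eta> (\<lambda>x'. ennreal (G x') / (\<integral>\<^sup>+ z. ennreal (G z) \<partial>\<eta>))) A)"

lemma sets_selection_kernel [simp, measurable_cong]: "sets (selection_kernel \<epsilon> G \<eta> x) = sets \<eta>"
  and space_selection_kernel [simp]: "space (selection_kernel \<epsilon> G \<eta> x) = space \<eta>"
  by (simp_all add: selection_kernel_def)

lemma emeasure_selection_kernel:
  assumes "A \<in> sets \<eta>"
  shows "emeasure (selection_kernel \<epsilon> G \<eta> x) A =
     ennreal (\<epsilon> * G x) * emeasure (return \<eta> x) A
     + ennreal (1 - \<epsilon> * G x)
       * emeasure (density \<eta> (\<lambda>x'. ennreal (G x') / (\<integral>\<^sup>+ z. ennreal (G z) \<partial>\<eta>))) A"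
  using assms unfolding selection_kernel_def
proof (rule emeasure_measure_of_sigma[OF sets.sigma_algebra_axioms, rotated 2])
  let ?d = "density \<eta> (\<lambda>x'. ennreal (G x') / (\<integral>\<^sup>+ z. ennreal (G z) \<partial>\<eta>))"
  show "countably_additive (sets \<eta>)
    (\<lambda>A. ennreal (\<epsilon> * G x) * emeasure (return \<eta> x) A + ennreal (1 - \<epsilon> * G x) * emeasure ?d A)"
  proof (intro countably_additiveI)
    fix B :: "nat \<Rightarrow> 'a set" assume B: "range B \<subseteq> sets \<eta>" "disjoint_family B"
    have "(\<Sum>i. emeasure (return \<eta> x) (B i)) = emeasure (return \<eta> x) (\<Union> (range B))"
      using B by (intro suminf_emeasure) auto
    moreover have "(\<Sum>i. emeasure ?d (B i)) = emeasure ?d (\<Union> (range B))"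
      using B by (intro suminf_emeasure) auto
    ultimately show "(\<Sum>i. ennreal (\<epsilon> * G x) * emeasure (return \<eta> x) (B i)
        + ennreal (1 - \<epsilon> * G x) * emeasure ?d (B i))
      = ennreal (\<epsilon> * G x) * emeasure (return \<eta> x) (\<Union> (range B))
        + ennreal (1 - \<epsilon> * G x) * emeasure ?d (\<Union> (range B))"
      by (simp add: suminf_add[symmetric])
  qed
qed (simp_all add: positive_def)

text \<open>The \<open>\<sigma>\<close>-algebra generated by \<open>\<xi>\<^sub>0, \<dots>, \<xi>\<^sub>k\<close>; here \<open>\<xi> j i\<close> is the \<open>i\<close>-th particle at time \<open>j\<close>.\<close>

definition past_algebra ::
  "'w measure \<Rightarrow> nat \<Rightarrow> (nat \<Rightarrow> 'a measure) \<Rightarrow> (nat \<Rightarrow> nat \<Rightarrow> 'w \<Rightarrow> 'a) \<Rightarrow> nat \<Rightarrow> 'w measure" where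
  "past_algebra P N E \<xi> k =
     sigma (space P) {\<xi> j i -` A \<inter> space P | j i A. j \<le> k \<and> i \<in> {1..N} \<and> A \<in> sets (E j)}"

text \<open>
  The last conjunct states conditional independence and the conditional laws at once: given the
  past, the probability that \<open>\<xi>\<^bsub>k+1\<^esub>\<^sup>i \<in> B i\<close> for all \<open>i\<close> is the product of the
  \<open>(S\<^bsub>k,\<eta>\<^esub> M\<^bsub>k+1\<^esub>)(\<xi>\<^sub>k\<^sup>i, B i)\<close>, with \<open>\<eta>\<close> the empirical measure of \<open>\<xi>\<^sub>k\<close>.
\<close>

definition particle_system ::
  "'w measure \<Rightarrow> nat \<Rightarrow> nat \<Rightarrow> real \<Rightarrow> (nat \<Rightarrow> 'a measure) \<Rightarrow> 'a measure \<Rightarrow> (nat \<Rightarrow> 'a \<Rightarrow> 'a measure)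
    \<Rightarrow> (nat \<Rightarrow> 'a \<Rightarrow> real) \<Rightarrow> (nat \<Rightarrow> nat \<Rightarrow> 'w \<Rightarrow> 'a) \<Rightarrow> bool" where
  "particle_system P n N \<epsilon> E \<eta>0 M G \<xi> \<longleftrightarrow>
     prob_space P \<and>
     (\<forall>k\<le>n. \<forall>i\<in>{1..N}. \<xi> k i \<in> P \<rightarrow>\<^sub>M E k) \<and>
     prob_space.indep_vars P (\<lambda>_. E 0) (\<xi> 0) {1..N} \<and>
     (\<forall>i\<in>{1..N}. distr P (E 0) (\<xi> 0 i) = \<eta>0) \<and>
     (\<forall>k<n. \<forall>B. (\<forall>i\<in>{1..N}. B i \<in> sets (E (Suc k))) \<longrightarrow>
       (AE \<omega> in P.
         nn_cond_exp P (past_algebra P N E \<xi> k)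
           (indicator {\<omega> \<in> space P. \<forall>i\<in>{1..N}. \<xi> (Suc k) i \<omega> \<in> B i}) \<omega>
         = (\<Prod>i\<in>{1..N}. emeasure
              (selection_kernel \<epsilon> (G k) (empirical_measure N (E k) (\<lambda>j. \<xi> k j \<omega>)) (\<xi> k i \<omega>)
                \<bind> M (Suc k)) (B i))))"

text \<open>The values at times \<open>k > n\<close> are irrelevant.\<close>

function snell :: "nat \<Rightarrow> (nat \<Rightarrow> 'a \<Rightarrow> real) \<Rightarrow> (nat \<Rightarrow> 'a \<Rightarrow> real) \<Rightarrow> (nat \<Rightarrow> 'a \<Rightarrow> 'a measure)
    \<Rightarrow> nat \<Rightarrow> 'a \<Rightarrow> ennreal" where
  "snell n f G M k x =
     (if k < n
      then max (ennreal (f k x))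
             (ennreal (G k x) * (\<integral>\<^sup>+ y. snell n f G M (Suc k) y \<partial>M (Suc k) x))
      else ennreal (f k x))"
  by auto
termination by (relation "Wellfounded.measure (\<lambda>(n, f, G, M, k, x). n - k)") auto

declare snell.simps [simp del]

text \<open>The argument \<open>\<eta> k\<close> stands for a realisation of the empirical measure at time \<open>k\<close>.
  When \<open>\<eta> k (G k) > 0\<close> and \<open>H > 0\<close> the denominator is positive; no value is prescribed otherwise beyond
  the division convention of \<^typ>\<open>ennreal\<close>.\<close>

function snell_approx :: "nat \<Rightarrow> (nat \<Rightarrow> 'a \<Rightarrow> real) \<Rightarrow> (nat \<Rightarrow> 'a \<Rightarrow> real)
    \<Rightarrow> (nat \<Rightarrow> 'a \<Rightarrow> 'a \<Rightarrow> real) \<Rightarrow> (nat \<Rightarrow> 'a measure) \<Rightarrow> nat \<Rightarrow> 'a \<Rightarrow> ennreal" where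
  "snell_approx n f G H \<eta> k x =
     (if k < n
      then max (ennreal (f k x))
             (\<integral>\<^sup>+ y. ennreal (G k x * H (Suc k) x y) * (\<integral>\<^sup>+ z. ennreal (G k z) \<partial>\<eta> k)
                   / (\<integral>\<^sup>+ z. ennreal (G k z * H (Suc k) z y) \<partial>\<eta> k)
                   * snell_approx n f G H \<eta> (Suc k) y \<partial>\<eta> (Suc k))
      else ennreal (f k x))"
  by auto
termination by (relation "Wellfounded.measure (\<lambda>(n, f, G, H, \<eta>, k, x). n - k)") auto

declare snell_approx.simps [simp del]

end

theory Submission imports Defs begin

text \<open>
  Let \<open>w\<close> be the approximation of the Snell envelope \<open>v\<close>, and \<open>\<F>\<^sub>j\<close> the past of the particles.
  Backward induction on \<open>j\<close> gives \<open>E(\<phi> v\<^sub>j(Y)) \<le> E(\<phi> w\<^sub>j(Y))\<close> for all \<open>\<F>\<^sub>j\<close>-measurable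
  \<open>\<phi> \<ge> 0\<close> and \<open>Y\<close>. Allowing a random point \<open>Y\<close> is essential, because \<open>w\<^sub>j\<close> evaluates \<open>w\<^bsub>j+1\<^esub>\<close>
  at the particles themselves. In the induction step, the maximum is bounded below by the branch that
  is optimal for \<open>v\<^sub>j\<close>, which is an \<open>\<F>\<^sub>j\<close>-measurable choice. The averaged transition of the
  particles does not depend on \<open>\<epsilon>\<close>, since \<open>\<eta> S\<^bsub>j,\<eta>\<^esub>\<close> is \<open>\<eta>\<close> reweighted by \<open>G\<^sub>j\<close>; its density
  with respect to \<open>\<lambda>\<^bsub>j+1\<^esub>\<close> is the reciprocal of the factor in \<open>w\<^sub>j\<close>, up to
  \<open>G\<^sub>j(x) H\<^bsub>j+1\<^esub>(x, y)\<close>.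
\<close>

section \<open>Disintegration along a sub-sigma-algebra\<close>

text \<open>The hypothesis \<open>law\<close> fixes the joint law of \<open>\<omega>\<close> and
  \<open>X \<omega>\<close> on all rectangles with sides in \<open>F\<close> and \<open>E\<close>,
  each exceptional null set being allowed to depend on \<open>B\<close>. Rectangles determine a
  finite measure on the product, so integrands that mix the past with \<open>X\<close> can be
  integrated first along the kernel.\<close>

lemma nn_integral_cond_kernel:
  assumes "prob_space P" and sub: "subalgebra P F"
    and X[measurable]: "X \<in> P \<rightarrow>\<^sub>M E"
    and K: "K \<in> F \<rightarrow>\<^sub>M subprob_algebra E"
    and law: "\<And>B. B \<in> sets E \<Longrightarrow>
      AE \<omega> in P. nn_cond_exp P F (indicator (X -` B \<inter> space P)) \<omega> = emeasure (K \<omega>) B"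
    and h[measurable]: "case_prod h \<in> borel_measurable (F \<Otimes>\<^sub>M E)"
  shows "(\<integral>\<^sup>+ \<omega>. h \<omega> (X \<omega>) \<partial>P) = (\<integral>\<^sup>+ \<omega>. (\<integral>\<^sup>+ y. h \<omega> y \<partial>K \<omega>) \<partial>P)"
proof -
  interpret prob_space P by fact
  interpret finite_measure_subalgebra P F
    by unfold_locales fact
  let ?R = "restr_to_subalg P F"
  have sF: "space F = space P" "sets F \<subseteq> sets P"
    using sub by (auto simp: subalgebra_def)
  have [measurable_cong]: "sets ?R = sets F"
    by (rule sets_restr_to_subalg[OF sub])
  have K'[measurable]: "K \<in> ?R \<rightarrow>\<^sub>M subprob_algebra E"
    using K by (simp cong: measurable_cong_sets)
  note K[measurable]
  have [simp]: "space ?R = space P"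
    by (rule space_restr_to_subalg)
  have "(\<lambda>\<omega>. \<omega>) \<in> P \<rightarrow>\<^sub>M F"
    using sF by (auto simp: measurable_def)
  then have pair: "(\<lambda>\<omega>. (\<omega>, X \<omega>)) \<in> P \<rightarrow>\<^sub>M F \<Otimes>\<^sub>M E"
    using X by (rule measurable_Pair)
  \<comment> \<open>This is the product of the Dirac mass at \<open>\<omega>\<close> with
    \<open>K \<omega>\<close>: the past is kept and the new coordinate is drawn from the
    kernel.\<close>
  let ?Q = "\<lambda>\<omega>. distr (K \<omega>) (F \<Otimes>\<^sub>M E) (Pair \<omega>)"
  have Q[measurable]: "?Q \<in> ?R \<rightarrow>\<^sub>M subprob_algebra (F \<Otimes>\<^sub>M E)"
    by (rule measurable_distr2[where M=E]) measurable
  have sK: "sets (K \<omega>) = sets E" if "\<omega> \<in> space P" for \<omega>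
    using measurable_space[OF K] that sF by (auto simp: space_subprob_algebra)
  let ?D = "distr P (F \<Otimes>\<^sub>M E) (\<lambda>\<omega>. (\<omega>, X \<omega>))"
  \<comment> \<open>Rectangles are stable under intersection and generate the product; the constant
    exhausting sequence suffices because \<open>?D\<close> is finite.\<close>
  have "?D = ?R \<bind> ?Q"
  proof (rule measure_eqI_generator_eq[OF Int_stable_pair_measure_generator[of F E],
        where \<Omega> = "space F \<times> space E" and A = "\<lambda>_. space F \<times> space E"])
    show "{a \<times> b |a b. a \<in> sets F \<and> b \<in> sets E} \<subseteq> Pow (space F \<times> space E)"
      by (auto dest: sets.sets_into_space)
    show "sets ?D = sigma_sets (space F \<times> space E) {a \<times> b |a b. a \<in> sets F \<and> b \<in> sets E}"
      by (simp add: sets_pair_measure)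
    have "sets (?R \<bind> ?Q) = sets (F \<Otimes>\<^sub>M E)"
      by (rule sets_bind[where N = "F \<Otimes>\<^sub>M E"]) (auto simp: not_empty)
    then show "sets (?R \<bind> ?Q) = sigma_sets (space F \<times> space E) {a \<times> b |a b. a \<in> sets F \<and> b \<in> sets E}"
      by (simp add: sets_pair_measure)
    show "emeasure ?D (space F \<times> space E) \<noteq> \<infinity>"
      by (subst emeasure_distr[OF pair]) (auto intro: emeasure_finite)
    fix S assume "S \<in> {a \<times> b |a b. a \<in> sets F \<and> b \<in> sets E}"
    then obtain A B where S: "S = A \<times> B" and A[measurable]: "A \<in> sets F" and B[measurable]: "B \<in> sets E"
      by auto
    have A'[measurable]: "A \<in> sets P" using A sF by auto
    have XB: "X -` B \<inter> space P \<in> sets P" by (rule measurable_sets[OF X B])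
    have "emeasure ?D S = emeasure P (A \<inter> (X -` B \<inter> space P))"
      unfolding S by (subst emeasure_distr[OF pair]) (auto intro!: arg_cong2[where f=emeasure])
    also have "\<dots> = (\<integral>\<^sup>+\<omega>. indicator A \<omega> * indicator (X -` B \<inter> space P) \<omega> \<partial>P)"
      unfolding indicator_inter_arith[symmetric]
      by (rule nn_integral_indicator[OF sets.Int[OF A' XB], symmetric])
    \<comment> \<open>The indicator of \<open>A\<close> is \<open>F\<close>-measurable, so this is
      the defining property of the conditional expectation.\<close>
    also have "\<dots> = (\<integral>\<^sup>+\<omega>. indicator A \<omega> * nn_cond_exp P F (indicator (X -` B \<inter> space P)) \<omega> \<partial>P)"
      by (rule nn_cond_exp_intg[OF borel_measurable_indicator[OF A]
            borel_measurable_indicator[OF XB], symmetric])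
    also have "\<dots> = (\<integral>\<^sup>+\<omega>. indicator A \<omega> * emeasure (K \<omega>) B \<partial>P)"
      using law[OF B] by (intro nn_integral_cong_AE) auto
    also have "\<dots> = (\<integral>\<^sup>+\<omega>. indicator A \<omega> * emeasure (K \<omega>) B \<partial>?R)"
      by (rule nn_integral_subalgebra2[OF sub, symmetric]) measurable
    also have "\<dots> = (\<integral>\<^sup>+\<omega>. emeasure (?Q \<omega>) S \<partial>?R)"
    proof (rule nn_integral_cong)
      fix \<omega> assume "\<omega> \<in> space ?R"
      then have \<omega>: "\<omega> \<in> space P" by simp
      have [measurable]: "Pair \<omega> \<in> K \<omega> \<rightarrow>\<^sub>M F \<Otimes>\<^sub>M E"
        using \<omega> sF by (subst measurable_cong_sets[OF sK[OF \<omega>] refl]) auto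
      have "space (K \<omega>) = space E" using sK[OF \<omega>] by (rule sets_eq_imp_space_eq)
      then have "Pair \<omega> -` S \<inter> space (K \<omega>) = (if \<omega> \<in> A then B else {})"
        using sets.sets_into_space[OF B] by (auto simp: S)
      then show "indicator A \<omega> * emeasure (K \<omega>) B = emeasure (?Q \<omega>) S"
        by (subst emeasure_distr) (auto simp: S)
    qed
    also have "\<dots> = emeasure (?R \<bind> ?Q) S"
      by (rule emeasure_bind[symmetric, OF _ Q]) (auto simp: not_empty S)
    finally show "emeasure ?D S = emeasure (?R \<bind> ?Q) S" .
  qed auto
  then have "(\<integral>\<^sup>+ z. case_prod h z \<partial>?D) = (\<integral>\<^sup>+ z. case_prod h z \<partial>(?R \<bind> ?Q))"
    by simp
  also have "\<dots> = (\<integral>\<^sup>+ \<omega>. (\<integral>\<^sup>+ z. case_prod h z \<partial>?Q \<omega>) \<partial>?R)"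
    by (rule nn_integral_bind[OF h Q])
  also have "\<dots> = (\<integral>\<^sup>+ \<omega>. (\<integral>\<^sup>+ y. h \<omega> y \<partial>K \<omega>) \<partial>?R)"
  proof (rule nn_integral_cong)
    fix \<omega> assume "\<omega> \<in> space ?R"
    then have \<omega>: "\<omega> \<in> space P" by simp
    have Pair: "Pair \<omega> \<in> K \<omega> \<rightarrow>\<^sub>M F \<Otimes>\<^sub>M E"
      using \<omega> sF by (subst measurable_cong_sets[OF sK[OF \<omega>] refl]) auto
    show "(\<integral>\<^sup>+ z. case_prod h z \<partial>?Q \<omega>) = (\<integral>\<^sup>+ y. h \<omega> y \<partial>K \<omega>)"
      using nn_integral_distr[OF Pair, of "case_prod h"] h by simp
  qed
  also have "\<dots> = (\<integral>\<^sup>+ \<omega>. (\<integral>\<^sup>+ y. h \<omega> y \<partial>K \<omega>) \<partial>P)"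
    by (rule nn_integral_subalgebra2[OF sub], rule nn_integral_measurable_subprob_algebra2[OF h K])
  finally show ?thesis
    using nn_integral_distr[OF pair, of "case_prod h"] h by simp
qed

section \<open>Integrals against the selection kernel and finite mixtures\<close>

text \<open>The kernel is given by its values on sets, which settles indicators. Both sides are
  linear in \<open>h\<close> and continuous along increasing sequences, so the formula extends to
  all measurable \<open>h\<close>; the Dirac and density parts are evaluated only at the
  end.\<close>

lemma nn_integral_selection_kernel:
  assumes [measurable]: "G \<in> borel_measurable \<eta>" and x: "x \<in> space \<eta>" and h: "h \<in> borel_measurable \<eta>"
  shows "(\<integral>\<^sup>+ y. h y \<partial>selection_kernel \<epsilon> G \<eta> x)
    = ennreal (\<epsilon> * G x) * h x
      + ennreal (1 - \<epsilon> * G x)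
        * (\<integral>\<^sup>+ y. ennreal (G y) / (\<integral>\<^sup>+ z. ennreal (G z) \<partial>\<eta>) * h y \<partial>\<eta>)"
proof -
  let ?S = "selection_kernel \<epsilon> G \<eta> x" and ?r = "return \<eta> x"
  let ?d = "density \<eta> (\<lambda>y. ennreal (G y) / (\<integral>\<^sup>+ z. ennreal (G z) \<partial>\<eta>))"
  have "(\<integral>\<^sup>+ y. h y \<partial>?S)
    = ennreal (\<epsilon> * G x) * (\<integral>\<^sup>+ y. h y \<partial>?r) + ennreal (1 - \<epsilon> * G x) * (\<integral>\<^sup>+ y. h y \<partial>?d)"
    using h
  proof (induction rule: borel_measurable_induct)
    case (cong f g)
    have "(\<integral>\<^sup>+ y. f y \<partial>m) = (\<integral>\<^sup>+ y. g y \<partial>m)" if "space m = space \<eta>" for m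
      using cong(3) that by (intro nn_integral_cong) auto
    then show ?case using cong(4) by simp
  next
    case (set A)
    then show ?case by (simp add: emeasure_selection_kernel)
  next
    case (mult u c)
    then show ?case by (simp add: nn_integral_cmult algebra_simps)
  next
    case (add u v)
    then show ?case by (simp add: nn_integral_add algebra_simps)
  next
    case (seq U)
    have SUP: "(\<integral>\<^sup>+ y. (SUP i. U i) y \<partial>m) = (SUP i. \<integral>\<^sup>+ y. U i y \<partial>m)" if "sets m = sets \<eta>" for m
      unfolding SUP_apply using seq.hyps that
      by (intro nn_integral_monotone_convergence_SUP) (auto cong: measurable_cong_sets)
    \<comment> \<open>Both summands increase with \<open>i\<close>, so the supremum of their sums is
      the sum of their suprema.\<close>
    have inc: "incseq (\<lambda>i. a * (\<integral>\<^sup>+ y. U i y \<partial>m))" for a m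
      using \<open>incseq U\<close> by (auto simp: incseq_def le_fun_def intro!: mult_left_mono nn_integral_mono)
    show ?case
      by (simp del: SUP_apply Sup_apply add: SUP seq.IH SUP_mult_left_ennreal ennreal_SUP_add[OF inc inc])
  qed
  with x h show ?thesis
    by (simp add: nn_integral_return nn_integral_density)
qed

text \<open>Binding a weighted counting measure encodes the finite mixture of the measures
  \<open>K l\<close> with weights \<open>c l\<close>.\<close>

lemma nn_integral_bind_density_count_space:
  assumes "finite L" and K: "\<And>l. l \<in> L \<Longrightarrow> K l \<in> space (subprob_algebra E)"
    and h: "h \<in> borel_measurable E"
  shows "(\<integral>\<^sup>+ y. h y \<partial>(density (count_space L) c \<bind> K)) = (\<Sum>l\<in>L. c l * (\<integral>\<^sup>+ y. h y \<partial>K l))"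
proof -
  have "K \<in> density (count_space L) c \<rightarrow>\<^sub>M subprob_algebra E"
    using K by auto
  from nn_integral_bind[OF h this] show ?thesis
    using assms(1) by (simp add: nn_integral_density nn_integral_count_space_finite)
qed

text \<open>The mass that the mixture gives to a fixed set is a finite sum of products of measurable
  functions of \<open>\<omega>\<close>; the bound on the weights keeps the total mass at most
  1.\<close>

lemma measurable_bind_density_count_space:
  assumes L: "finite L" "L \<noteq> {}"
    and K[measurable]: "\<And>l. l \<in> L \<Longrightarrow> K l \<in> F \<rightarrow>\<^sub>M subprob_algebra E"
    and c[measurable]: "\<And>l. l \<in> L \<Longrightarrow> c l \<in> borel_measurable F"
    and c_le: "\<And>\<omega>. \<omega> \<in> space F \<Longrightarrow> (\<Sum>l\<in>L. c l \<omega>) \<le> 1"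
    and E: "space E \<noteq> {}"
  shows "(\<lambda>\<omega>. density (count_space L) (\<lambda>l. c l \<omega>) \<bind> (\<lambda>l. K l \<omega>)) \<in> F \<rightarrow>\<^sub>M subprob_algebra E"
    (is "?B \<in> _")
proof (rule measurable_subprob_algebra)
  have K': "K l \<omega> \<in> space (subprob_algebra E)" if "\<omega> \<in> space F" "l \<in> L" for \<omega> l
    using measurable_space[OF K] that by auto
  show s: "sets (?B \<omega>) = sets E" if "\<omega> \<in> space F" for \<omega>
    using K'[OF that] L by (subst sets_bind[where N = E]) (auto simp: space_subprob_algebra)
  have em: "emeasure (?B \<omega>) A = (\<Sum>l\<in>L. c l \<omega> * emeasure (K l \<omega>) A)"
    if "\<omega> \<in> space F" "A \<in> sets E" for \<omega> A
  proof -
    have "emeasure (?B \<omega>) A = (\<Sum>l\<in>L. c l \<omega> * (\<integral>\<^sup>+ y. indicator A y \<partial>K l \<omega>))"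
      using nn_integral_bind_density_count_space[where K = "\<lambda>l. K l \<omega>" and h = "indicator A"
            and c = "\<lambda>l. c l \<omega>", OF L(1) K'[OF that(1)]]
        that s by simp
    also have "\<dots> = (\<Sum>l\<in>L. c l \<omega> * emeasure (K l \<omega>) A)"
      using K'[OF that(1)] that(2) by (intro sum.cong) (auto simp: space_subprob_algebra)
    finally show ?thesis .
  qed
  show "subprob_space (?B \<omega>)" if "\<omega> \<in> space F" for \<omega>
  proof
    have "space (?B \<omega>) = space E" using s[OF that] by (rule sets_eq_imp_space_eq)
    then show "space (?B \<omega>) \<noteq> {}" using E by simp
    have "emeasure (K l \<omega>) (space E) \<le> 1" if "l \<in> L" for l
      using K'[OF \<open>\<omega> \<in> space F\<close> that]
      by (auto simp: space_subprob_algebra intro: subprob_space.subprob_emeasure_le_1)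
    then have "(\<Sum>l\<in>L. c l \<omega> * emeasure (K l \<omega>) (space E)) \<le> (\<Sum>l\<in>L. c l \<omega> * 1)"
      by (intro sum_mono mult_left_mono) auto
    then have "emeasure (?B \<omega>) (space E) \<le> (\<Sum>l\<in>L. c l \<omega>)"
      by (simp add: em[OF that])
    then show "emeasure (?B \<omega>) (space (?B \<omega>)) \<le> 1"
      using c_le[OF that] \<open>space (?B \<omega>) = space E\<close> by simp
  qed
  fix A assume [measurable]: "A \<in> sets E"
  have "(\<lambda>\<omega>. \<Sum>l\<in>L. c l \<omega> * emeasure (K l \<omega>) A) \<in> borel_measurable F"
    by (intro borel_measurable_sum borel_measurable_times_ennreal c
        measurable_emeasure_kernel[OF K]) auto
  then show "(\<lambda>\<omega>. emeasure (?B \<omega>) A) \<in> borel_measurable F"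
    by (subst measurable_cong[OF em]) auto
qed

text \<open>Selection from an empirical measure can only end at one of the \<open>N\<close> current
  positions, so selection followed by \<open>K\<close> is a finite mixture of the measures
  \<open>K (x l)\<close>. The Dirac part adds weight at \<open>l = i\<close> only.\<close>

lemma nn_integral_selection_kernel_bind:
  fixes x :: "nat \<Rightarrow> 'a" and G :: "'a \<Rightarrow> real"
  assumes x: "\<And>l. l \<in> {1..N} \<Longrightarrow> x l \<in> space E"
    and G[measurable]: "G \<in> borel_measurable E"
    and G_nonneg: "\<And>y. y \<in> space E \<Longrightarrow> 0 \<le> G y"
    and eps_G: "\<And>y. y \<in> space E \<Longrightarrow> \<epsilon> * G y \<in> {0..1}"
    and K[measurable]: "K \<in> E \<rightarrow>\<^sub>M subprob_algebra E'"
    and h[measurable]: "h \<in> borel_measurable E'"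
    and i: "i \<in> {1..N}"
    and pos: "0 < (\<Sum>l=1..N. G (x l))"
  shows "(\<integral>\<^sup>+ y. h y \<partial>(selection_kernel \<epsilon> G (empirical_measure N E x) (x i) \<bind> K))
    = (\<Sum>l=1..N. ennreal (\<epsilon> * G (x i) * of_bool (l = i)
          + (1 - \<epsilon> * G (x i)) * (G (x l) / (\<Sum>m=1..N. G (x m)))) * (\<integral>\<^sup>+ y. h y \<partial>K (x l)))"
proof -
  let ?\<eta> = "empirical_measure N E x" and ?S = "\<Sum>m=1..N. G (x m)"
  define g where "g y = (\<integral>\<^sup>+ z. h z \<partial>K y)" for y
  have g[measurable]: "g \<in> borel_measurable E"
    unfolding g_def by (rule nn_integral_measurable_subprob_algebra2[OF _ K]) measurable
  have N: "0 < real N" using i by auto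
  have Gx: "0 \<le> G (x l)" if "l \<in> {1..N}" for l using x G_nonneg that by auto
  have e: "0 \<le> \<epsilon> * G (x i)" "0 \<le> 1 - \<epsilon> * G (x i)" using eps_G[OF x[OF i]] by auto
  have sumG: "(\<Sum>l=1..N. ennreal (G (x l))) = ennreal ?S"
    by (rule sum_ennreal) (rule Gx)
  have mean: "(\<integral>\<^sup>+ z. ennreal (G z) \<partial>?\<eta>) = ennreal (?S / N)"
    using N pos
    by (subst nn_integral_empirical_measure[OF x])
       (auto simp: sumG[simplified] ennreal_of_nat_eq_real_of_nat divide_ennreal)
  have "(\<integral>\<^sup>+ y. ennreal (G y) / (\<integral>\<^sup>+ z. ennreal (G z) \<partial>?\<eta>) * g y \<partial>?\<eta>)
    = (\<Sum>l=1..N. ennreal (G (x l)) / ennreal (?S / N) * g (x l)) / of_nat N"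
    unfolding mean by (rule nn_integral_empirical_measure[OF x]) auto
  also have "\<dots> = (\<Sum>l=1..N. ennreal (G (x l)) / ennreal (?S / N) * g (x l) / of_nat N)"
    unfolding divide_ennreal_def by (rule sum_distrib_right)
  \<comment> \<open>The mean of \<open>G\<close> is \<open>?S / N\<close>; its factor
    \<open>1 / N\<close> cancels the one that comes from averaging over the particles.\<close>
  also have "\<dots> = (\<Sum>l=1..N. ennreal (G (x l) / ?S) * g (x l))"
  proof (rule sum.cong[OF refl])
    fix l assume l: "l \<in> {1..N}"
    have "ennreal (G (x l)) / ennreal (?S / N) * g (x l) / of_nat N
      = ennreal (G (x l)) / ennreal (?S / N) / ennreal N * g (x l)"
      by (simp add: divide_ennreal_def ennreal_of_nat_eq_real_of_nat algebra_simps)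
    also have "\<dots> = ennreal (G (x l) / ?S) * g (x l)"
      using N pos Gx[OF l] by (simp add: divide_ennreal)
    finally show "ennreal (G (x l)) / ennreal (?S / N) * g (x l) / of_nat N
      = ennreal (G (x l) / ?S) * g (x l)" .
  qed
  finally have avg: "(\<integral>\<^sup>+ y. ennreal (G y) / (\<integral>\<^sup>+ z. ennreal (G z) \<partial>?\<eta>) * g y \<partial>?\<eta>)
    = (\<Sum>l=1..N. ennreal (G (x l) / ?S) * g (x l))" .
  have "K \<in> selection_kernel \<epsilon> G ?\<eta> (x i) \<rightarrow>\<^sub>M subprob_algebra E'"
    by simp
  from nn_integral_bind[OF h this]
  have "(\<integral>\<^sup>+ y. h y \<partial>(selection_kernel \<epsilon> G ?\<eta> (x i) \<bind> K))
    = (\<integral>\<^sup>+ y. g y \<partial>selection_kernel \<epsilon> G ?\<eta> (x i))"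
    by (simp add: g_def)
  also have "\<dots> = ennreal (\<epsilon> * G (x i)) * g (x i)
      + ennreal (1 - \<epsilon> * G (x i)) * (\<Sum>l=1..N. ennreal (G (x l) / ?S) * g (x l))"
    using x[OF i] by (subst nn_integral_selection_kernel) (auto simp: avg)
  \<comment> \<open>The Dirac term is spread over all indices so that the two parts can be merged
    weight by weight.\<close>
  also have "ennreal (\<epsilon> * G (x i)) * g (x i)
      = (\<Sum>l=1..N. ennreal (\<epsilon> * G (x i) * of_bool (l = i)) * g (x l))"
    using i by (subst sum.remove[OF _ i]) (auto intro!: sum.neutral)
  also have "\<dots> + ennreal (1 - \<epsilon> * G (x i)) * (\<Sum>l=1..N. ennreal (G (x l) / ?S) * g (x l))
      = (\<Sum>l=1..N. ennreal (\<epsilon> * G (x i) * of_bool (l = i)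
          + (1 - \<epsilon> * G (x i)) * (G (x l) / ?S)) * g (x l))"
    unfolding sum_distrib_left sum.distrib[symmetric]
  proof (rule sum.cong[OF refl])
    fix l assume l: "l \<in> {1..N}"
    have "0 \<le> G (x l) / ?S" using Gx[OF l] pos by simp
    have combine: "ennreal u * w + ennreal v * (ennreal r * w) = ennreal (u + v * r) * w"
      if "0 \<le> u" "0 \<le> v" "0 \<le> r" for u v r :: real and w
      using that by (simp add: ennreal_plus ennreal_mult distrib_right mult.assoc)
    show "ennreal (\<epsilon> * G (x i) * of_bool (l = i)) * g (x l)
        + ennreal (1 - \<epsilon> * G (x i)) * (ennreal (G (x l) / ?S) * g (x l))
      = ennreal (\<epsilon> * G (x i) * of_bool (l = i) + (1 - \<epsilon> * G (x i)) * (G (x l) / ?S)) * g (x l)"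
      using e \<open>0 \<le> G (x l) / ?S\<close> by (intro combine) (auto simp: of_bool_def)
  qed
  finally show ?thesis unfolding g_def .
qed

section \<open>The particle model and its selection weights\<close>

locale particle_model =
  fixes n N :: nat
    and E lam :: "nat \<Rightarrow> 'a measure"
    and \<eta>0 :: "'a measure"
    and M :: "nat \<Rightarrow> 'a \<Rightarrow> 'a measure"
    and H :: "nat \<Rightarrow> 'a \<Rightarrow> 'a \<Rightarrow> real"
    and f G :: "nat \<Rightarrow> 'a \<Rightarrow> real"
    and \<epsilon> :: real
    and P :: "'w measure"
    and \<xi> :: "nat \<Rightarrow> nat \<Rightarrow> 'w \<Rightarrow> 'a"
  assumes N: "N \<ge> 1"
    and markov: "\<And>j. j < n \<Longrightarrow> M (Suc j) \<in> E j \<rightarrow>\<^sub>M prob_algebra (E (Suc j))"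
    and reference: "\<And>j. j < n \<Longrightarrow> sets (lam (Suc j)) = sets (E (Suc j))"
    and H_measurable:
      "\<And>j. j < n \<Longrightarrow> case_prod (H (Suc j)) \<in> borel_measurable (E j \<Otimes>\<^sub>M E (Suc j))"
    and H_pos:
      "\<And>j y z. j < n \<Longrightarrow> y \<in> space (E j) \<Longrightarrow> z \<in> space (E (Suc j)) \<Longrightarrow> 0 < H (Suc j) y z"
    and M_density:
      "\<And>j y. j < n \<Longrightarrow> y \<in> space (E j) \<Longrightarrow>
         M (Suc j) y = density (lam (Suc j)) (\<lambda>z. ennreal (H (Suc j) y z))"
    and f_measurable: "\<And>j. j \<le> n \<Longrightarrow> f j \<in> borel_measurable (E j)"
    and G_measurable: "\<And>j. j \<le> n \<Longrightarrow> G j \<in> borel_measurable (E j)"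
    and G_nonneg: "\<And>j y. j \<le> n \<Longrightarrow> y \<in> space (E j) \<Longrightarrow> 0 \<le> G j y"
    and eps_G: "\<And>j y. j \<le> n \<Longrightarrow> y \<in> space (E j) \<Longrightarrow> \<epsilon> * G j y \<in> {0..1}"
    and particles: "particle_system P n N \<epsilon> E \<eta>0 M G \<xi>"
    and well_defined: "\<And>j. j < n \<Longrightarrow>
      AE \<omega> in P. 0 < (\<integral>\<^sup>+ y. ennreal (G j y) \<partial>empirical_measure N (E j) (\<lambda>i. \<xi> j i \<omega>))"
begin

abbreviation past :: "nat \<Rightarrow> 'w measure" where
  "past j \<equiv> past_algebra P N E \<xi> j"

abbreviation emp :: "'w \<Rightarrow> nat \<Rightarrow> 'a measure" where
  "emp \<omega> j \<equiv> empirical_measure N (E j) (\<lambda>i. \<xi> j i \<omega>)"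

definition weight_sum :: "nat \<Rightarrow> 'w \<Rightarrow> real" where
  "weight_sum j \<omega> = (\<Sum>l=1..N. G j (\<xi> j l \<omega>))"

text \<open>Where \<open>weight_sum\<close> is positive, this is the probability that selection
  takes the position of particle \<open>l\<close> for particle \<open>i\<close>. On the event
  \<open>weight_sum j \<omega> = 0\<close> the quotient is 0 and only the Dirac part
  remains.\<close>

definition transition_weight :: "nat \<Rightarrow> nat \<Rightarrow> nat \<Rightarrow> 'w \<Rightarrow> real" where
  "transition_weight j i l \<omega> = \<epsilon> * G j (\<xi> j i \<omega>) * of_bool (l = i)
     + (1 - \<epsilon> * G j (\<xi> j i \<omega>)) * (G j (\<xi> j l \<omega>) / weight_sum j \<omega>)"

text \<open>The factor in front of the next value in \<open>snell_approx\<close>, with the empirical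
  integrals written out as particle averages. It depends on \<open>\<omega>\<close> only through the
  particles at time \<open>j\<close>.\<close>

definition backward_weight :: "nat \<Rightarrow> 'w \<Rightarrow> 'a \<Rightarrow> 'a \<Rightarrow> ennreal" where
  "backward_weight j \<omega> x y = ennreal (G j x * H (Suc j) x y)
     * ((\<Sum>l=1..N. ennreal (G j (\<xi> j l \<omega>))) / of_nat N)
     / ((\<Sum>l=1..N. ennreal (G j (\<xi> j l \<omega>) * H (Suc j) (\<xi> j l \<omega>) y)) / of_nat N)"

lemma prob_space_P: "prob_space P"
  using particles by (simp add: particle_system_def)

lemma particle_measurable: "j \<le> n \<Longrightarrow> i \<in> {1..N} \<Longrightarrow> \<xi> j i \<in> P \<rightarrow>\<^sub>M E j"
  using particles by (simp add: particle_system_def)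

lemma particle_in_space: "j \<le> n \<Longrightarrow> i \<in> {1..N} \<Longrightarrow> \<omega> \<in> space P \<Longrightarrow> \<xi> j i \<omega> \<in> space (E j)"
  by (rule measurable_space[OF particle_measurable])

lemma space_E_nonempty: "j \<le> n \<Longrightarrow> space (E j) \<noteq> {}"
  using particle_in_space[of j 1] prob_space.not_empty[OF prob_space_P] N by fastforce

lemma space_past [simp]: "space (past j) = space P"
  by (simp add: past_algebra_def space_measure_of_conv)

lemma sets_past: "sets (past j) = sigma_sets (space P)
    {\<xi> j' i -` A \<inter> space P | j' i A. j' \<le> j \<and> i \<in> {1..N} \<and> A \<in> sets (E j')}"
  unfolding past_algebra_def by (rule sets_measure_of) auto

lemma subalgebra_past: "j \<le> n \<Longrightarrow> subalgebra P (past j)"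
  unfolding subalgebra_def sets_past
  by (auto intro!: sets.sigma_sets_subset measurable_sets particle_measurable)

lemma past_mono: "j' \<le> j \<Longrightarrow> sets (past j') \<subseteq> sets (past j)"
  unfolding sets_past by (rule sigma_sets_mono') (auto; metis order_trans)

lemma particle_measurable_past:
  assumes "j' \<le> j" "j' \<le> n" "i \<in> {1..N}"
  shows "\<xi> j' i \<in> past j \<rightarrow>\<^sub>M E j'"
  using particle_in_space[OF assms(2,3)] assms
  by (intro measurableI) (auto simp: sets_past intro!: sigma_sets.Basic)

lemma measurable_past_mono:
  assumes "j' \<le> j" and X: "X \<in> past j' \<rightarrow>\<^sub>M A"
  shows "X \<in> past j \<rightarrow>\<^sub>M A"
  using past_mono[OF assms(1)] X by (auto simp: measurable_def)

lemma transition_weight_nonneg: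
  assumes "j \<le> n" "i \<in> {1..N}" "l \<in> {1..N}" "\<omega> \<in> space P"
  shows "0 \<le> transition_weight j i l \<omega>"
proof -
  have "0 \<le> weight_sum j \<omega>"
    unfolding weight_sum_def using assms by (intro sum_nonneg G_nonneg particle_in_space) auto
  then have "0 \<le> G j (\<xi> j l \<omega>) / weight_sum j \<omega>"
    using assms by (simp add: G_nonneg particle_in_space)
  moreover have "0 \<le> \<epsilon> * G j (\<xi> j i \<omega>)" "0 \<le> 1 - \<epsilon> * G j (\<xi> j i \<omega>)"
    using eps_G[OF assms(1) particle_in_space[OF assms(1,2,4)]] by auto
  ultimately show ?thesis
    unfolding transition_weight_def
    by (metis add_nonneg_nonneg mult_nonneg_nonneg of_bool_def zero_le_one order_refl)
qed

text \<open>The zero case comes from division by zero being 0. In both cases \<open>eps_G\<close>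
  bounds the row sum by 1, so the weights define a sub-probability for every \<open>\<omega>\<close>
  in the space and not just almost surely.\<close>

lemma sum_transition_weight:
  assumes "i \<in> {1..N}"
  shows "(\<Sum>l=1..N. transition_weight j i l \<omega>)
    = (if weight_sum j \<omega> = 0 then \<epsilon> * G j (\<xi> j i \<omega>) else 1)"
proof -
  have "(\<Sum>l=1..N. transition_weight j i l \<omega>) = \<epsilon> * G j (\<xi> j i \<omega>)
      + (1 - \<epsilon> * G j (\<xi> j i \<omega>)) * (weight_sum j \<omega> / weight_sum j \<omega>)"
    using assms
    by (simp add: transition_weight_def sum.distrib sum_distrib_left[symmetric] of_bool_def
        sum.delta weight_sum_def sum_divide_distrib[symmetric] if_distrib[of "(*) _"] cong: if_cong)
  then show ?thesis by simp
qed

text \<open>Here \<epsilon> disappears. Summed over \<open>i\<close>, the Dirac parts leave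
  \<open>\<epsilon> * G j (\<xi> j l \<omega>)\<close>, and the factors
  \<open>1 - \<epsilon> * G\<close> add up to \<open>N - \<epsilon> * weight_sum j \<omega>\<close>;
  the two contributions of \<epsilon> cancel.\<close>

lemma sum_transition_weight':
  assumes "l \<in> {1..N}" "0 < weight_sum j \<omega>"
  shows "(\<Sum>i=1..N. transition_weight j i l \<omega>) = N * (G j (\<xi> j l \<omega>) / weight_sum j \<omega>)"
proof -
  have "(\<Sum>i=1..N. transition_weight j i l \<omega>) = \<epsilon> * G j (\<xi> j l \<omega>)
      + (N - \<epsilon> * weight_sum j \<omega>) * (G j (\<xi> j l \<omega>) / weight_sum j \<omega>)"
    using assms(1)
    by (simp add: transition_weight_def sum.distrib of_bool_def sum.delta
        if_distrib[of "(*) _"] cong: if_cong)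
       (simp add: weight_sum_def sum_distrib_left[symmetric] sum_distrib_right[symmetric]
        sum_subtractf sum_divide_distrib[symmetric])
  with assms(2) show ?thesis by (simp add: field_simps)
qed

lemma weight_sum_pos:
  assumes j: "j < n"
  shows "AE \<omega> in P. 0 < weight_sum j \<omega>"
  using well_defined[OF j] AE_space
proof eventually_elim
  case (elim \<omega>)
  then have x: "\<xi> j l \<omega> \<in> space (E j)" if "l \<in> {1..N}" for l
    using that j particle_in_space by auto
  have [measurable]: "G j \<in> borel_measurable (E j)" using G_measurable j by simp
  have "(\<Sum>l=1..N. ennreal (G j (\<xi> j l \<omega>))) = ennreal (weight_sum j \<omega>)"
    unfolding weight_sum_def using x j by (intro sum_ennreal G_nonneg) auto
  then have "(\<integral>\<^sup>+ y. ennreal (G j y) \<partial>emp \<omega> j) = ennreal (weight_sum j \<omega>) / of_nat N"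
    using x by (subst nn_integral_empirical_measure) auto
  with elim(1) show ?case by (auto simp: not_less ennreal_neg intro: ccontr)
qed

section \<open>The conditional law of the next particles\<close>

lemma M_subprob: "j < n \<Longrightarrow> M (Suc j) \<in> E j \<rightarrow>\<^sub>M subprob_algebra (E (Suc j))"
  by (rule measurable_prob_algebraD[OF markov])

text \<open>Almost surely this is the law of particle \<open>i\<close> after selection and mutation.
  Mixing over indices makes its dependence on \<open>\<omega>\<close> explicit, so measurability
  with respect to the past reduces to that of the weights and positions.\<close>

definition transition_kernel :: "nat \<Rightarrow> nat \<Rightarrow> 'w \<Rightarrow> 'a measure" where
  "transition_kernel j i \<omega> = density (count_space {1..N}) (\<lambda>l. ennreal (transition_weight j i l \<omega>))
     \<bind> (\<lambda>l. M (Suc j) (\<xi> j l \<omega>))"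

lemma M_particle_subprob:
  "j < n \<Longrightarrow> l \<in> {1..N} \<Longrightarrow> \<omega> \<in> space P \<Longrightarrow>
    M (Suc j) (\<xi> j l \<omega>) \<in> space (subprob_algebra (E (Suc j)))"
  using measurable_space[OF M_subprob particle_in_space] by simp

lemma nn_integral_transition_kernel:
  assumes "j < n" "\<omega> \<in> space P" "h \<in> borel_measurable (E (Suc j))"
  shows "(\<integral>\<^sup>+ y. h y \<partial>transition_kernel j i \<omega>)
    = (\<Sum>l=1..N. ennreal (transition_weight j i l \<omega>) * (\<integral>\<^sup>+ y. h y \<partial>M (Suc j) (\<xi> j l \<omega>)))"
  unfolding transition_kernel_def
  by (rule nn_integral_bind_density_count_space[OF _ M_particle_subprob[OF assms(1) _ assms(2)]
        assms(3)]) simp_all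

lemma G_particle_measurable:
  "j \<le> n \<Longrightarrow> i \<in> {1..N} \<Longrightarrow> (\<lambda>\<omega>. G j (\<xi> j i \<omega>)) \<in> borel_measurable (past j)"
  using measurable_compose[OF particle_measurable_past G_measurable] by simp

lemma weight_sum_measurable: "j \<le> n \<Longrightarrow> weight_sum j \<in> borel_measurable (past j)"
  unfolding weight_sum_def by (intro borel_measurable_sum G_particle_measurable) auto

lemma transition_weight_measurable:
  "j \<le> n \<Longrightarrow> i \<in> {1..N} \<Longrightarrow> l \<in> {1..N} \<Longrightarrow> transition_weight j i l \<in> borel_measurable (past j)"
  unfolding transition_weight_def
  by (intro borel_measurable_add borel_measurable_times borel_measurable_divide
      borel_measurable_diff borel_measurable_const G_particle_measurable weight_sum_measurable)

lemma transition_kernel_measurable: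
  assumes j: "j < n" and i: "i \<in> {1..N}"
  shows "transition_kernel j i \<in> past j \<rightarrow>\<^sub>M subprob_algebra (E (Suc j))"
  unfolding transition_kernel_def
proof (rule measurable_bind_density_count_space)
  show "(\<lambda>\<omega>. M (Suc j) (\<xi> j l \<omega>)) \<in> past j \<rightarrow>\<^sub>M subprob_algebra (E (Suc j))"
    if "l \<in> {1..N}" for l
    using j that by (intro measurable_compose[OF particle_measurable_past M_subprob]) auto
  show "(\<lambda>\<omega>. ennreal (transition_weight j i l \<omega>)) \<in> borel_measurable (past j)" if "l \<in> {1..N}" for l
    using transition_weight_measurable[of j i l] j i that by simp
  show "(\<Sum>l=1..N. ennreal (transition_weight j i l \<omega>)) \<le> 1" if "\<omega> \<in> space (past j)" for \<omega>
  proof -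
    have "(\<Sum>l=1..N. ennreal (transition_weight j i l \<omega>))
        = ennreal (\<Sum>l=1..N. transition_weight j i l \<omega>)"
      using that i j by (intro sum_ennreal transition_weight_nonneg) auto
    \<comment> \<open>This covers the event \<open>weight_sum j \<omega> = 0\<close>, where the
      total mass is \<open>\<epsilon> * G j (\<xi> j i \<omega>)\<close>.\<close>
    moreover have "\<epsilon> * G j (\<xi> j i \<omega>) \<in> {0..1}"
      using that i j by (intro eps_G particle_in_space) auto
    ultimately show ?thesis
      by (auto simp: sum_transition_weight[OF i, simplified] ennreal_le_1)
  qed
qed (use j N space_E_nonempty in auto)

text \<open>The product formula of \<open>particle_system\<close> is reduced to its marginal for
  particle \<open>i\<close>, and the selection kernel is replaced by the explicit mixture in the
  form that \<open>nn_integral_cond_kernel\<close> requires.\<close>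

lemma particle_conditional_law:
  assumes j: "j < n" and i: "i \<in> {1..N}" and B: "B \<in> sets (E (Suc j))"
  shows "AE \<omega> in P. nn_cond_exp P (past j) (indicator (\<xi> (Suc j) i -` B \<inter> space P)) \<omega>
    = emeasure (transition_kernel j i \<omega>) B"
proof -
  \<comment> \<open>Leaving the other particles unconstrained turns the joint event into one about
    particle \<open>i\<close> alone.\<close>
  define B' where "B' i' = (if i' = i then B else space (E (Suc j)))" for i'
  have B': "B' i' \<in> sets (E (Suc j))" for i' using B by (simp add: B'_def)
  have set_eq: "{\<omega> \<in> space P. \<forall>i'\<in>{1..N}. \<xi> (Suc j) i' \<omega> \<in> B' i'} = \<xi> (Suc j) i -` B \<inter> space P"
    using i j particle_in_space[of "Suc j"] by (auto simp: B'_def)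
  have "AE \<omega> in P. nn_cond_exp P (past j)
        (indicator {\<omega> \<in> space P. \<forall>i'\<in>{1..N}. \<xi> (Suc j) i' \<omega> \<in> B' i'}) \<omega>
      = (\<Prod>i'\<in>{1..N}. emeasure (selection_kernel \<epsilon> (G j) (emp \<omega> j) (\<xi> j i' \<omega>) \<bind> M (Suc j)) (B' i'))"
    using particles j B' unfolding particle_system_def by blast
  then show ?thesis
    unfolding set_eq using weight_sum_pos[OF j] AE_space
  proof eventually_elim
    case (elim \<omega>)
    let ?S = "\<lambda>i'. selection_kernel \<epsilon> (G j) (emp \<omega> j) (\<xi> j i' \<omega>) \<bind> M (Suc j)"
    have \<omega>: "\<omega> \<in> space P" by fact
    \<comment> \<open>Where \<open>weight_sum\<close> is positive, both kernels are the same mixture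
      of the laws \<open>M (Suc j) (\<xi> j l \<omega>)\<close>.\<close>
    have K: "emeasure (transition_kernel j i' \<omega>) A
        = (\<Sum>l=1..N. ennreal (transition_weight j i' l \<omega>) * emeasure (M (Suc j) (\<xi> j l \<omega>)) A)"
      and S: "emeasure (?S i') A = emeasure (transition_kernel j i' \<omega>) A"
      if "i' \<in> {1..N}" and A: "A \<in> sets (E (Suc j))" for i' A
    proof -
      have sM: "sets (M (Suc j) (\<xi> j l \<omega>)) = sets (E (Suc j))" if "l \<in> {1..N}" for l
        using M_particle_subprob[OF j that \<omega>] by (simp add: space_subprob_algebra)
      have sK: "sets (transition_kernel j i' \<omega>) = sets (E (Suc j))"
        using measurable_space[OF transition_kernel_measurable[OF j that(1)]] \<omega>
        by (simp add: space_subprob_algebra)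
      have sS: "sets (?S i') = sets (E (Suc j))"
        using j space_E_nonempty[of j] measurable_space[OF M_subprob[OF j]]
        by (subst sets_bind[where N = "E (Suc j)"]) (auto simp: space_subprob_algebra)
      have ind: "indicator A \<in> borel_measurable (E (Suc j))"
        using A by (rule borel_measurable_indicator)
      show K: "emeasure (transition_kernel j i' \<omega>) A
        = (\<Sum>l=1..N. ennreal (transition_weight j i' l \<omega>) * emeasure (M (Suc j) (\<xi> j l \<omega>)) A)"
        using nn_integral_transition_kernel[OF j \<omega> ind, of i'] A sM sK by simp
      have "(\<integral>\<^sup>+ y. indicator A y \<partial>?S i') = (\<Sum>l=1..N. ennreal (transition_weight j i' l \<omega>)
          * (\<integral>\<^sup>+ y. indicator A y \<partial>M (Suc j) (\<xi> j l \<omega>)))"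
        unfolding transition_weight_def weight_sum_def
        by (rule nn_integral_selection_kernel_bind)
          (use \<open>0 < weight_sum j \<omega>\<close> in \<open>auto simp: j less_imp_le \<omega> that(1)[simplified] weight_sum_def
            intro!: particle_in_space G_measurable G_nonneg eps_G[unfolded atLeastAtMost_iff]
              M_subprob ind\<close>)
      then show "emeasure (?S i') A = emeasure (transition_kernel j i' \<omega>) A"
        using A sM sS K by simp
    qed
    \<comment> \<open>The remaining factors of the product are 1: \<open>M\<close> is Markov, and
      the row sums equal 1 where \<open>weight_sum\<close> is positive.\<close>
    have one: "emeasure (?S i') (space (E (Suc j))) = 1" if i': "i' \<in> {1..N}" for i'
    proof -
      have "emeasure (M (Suc j) (\<xi> j l \<omega>)) (space (E (Suc j))) = 1" if "l \<in> {1..N}" for l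
      proof -
        have *: "M (Suc j) (\<xi> j l \<omega>) \<in> space (prob_algebra (E (Suc j)))"
          using j that \<omega> by (intro measurable_space[OF markov] particle_in_space) auto
        then have "prob_space (M (Suc j) (\<xi> j l \<omega>))" "sets (M (Suc j) (\<xi> j l \<omega>)) = sets (E (Suc j))"
          by (auto simp: space_prob_algebra)
        then show ?thesis
          using prob_space.emeasure_space_1 sets_eq_imp_space_eq by metis
      qed
      then have "emeasure (?S i') (space (E (Suc j))) = (\<Sum>l=1..N. ennreal (transition_weight j i' l \<omega>))"
        by (subst S[OF i'], simp, subst K[OF i']) auto
      also have "\<dots> = ennreal (\<Sum>l=1..N. transition_weight j i' l \<omega>)"
        using j i' \<omega> by (intro sum_ennreal transition_weight_nonneg) auto
      finally show ?thesis
        using \<open>0 < weight_sum j \<omega>\<close> by (simp add: sum_transition_weight[OF i', simplified])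
    qed
    have "(\<Prod>i'\<in>{1..N}. emeasure (?S i') (B' i')) = emeasure (?S i) B"
      using i one by (subst prod.remove[OF _ i]) (auto simp: B'_def intro!: prod.neutral)
    also have "\<dots> = emeasure (transition_kernel j i \<omega>) B"
      by (rule S[OF i B])
    finally show ?case using elim(1) by simp
  qed
qed

text \<open>Up to the factor \<open>N\<close>, the mean conditional law of the next particles is the
  current empirical measure reweighted by \<open>G j\<close> and moved by \<open>M (Suc j)\<close>.
  The integrand may depend on the past, since conditioning freezes that argument.\<close>

lemma nn_integral_next_particles:
  assumes j: "j < n" and h: "case_prod h \<in> borel_measurable (past j \<Otimes>\<^sub>M E (Suc j))"
  shows "(\<Sum>i=1..N. \<integral>\<^sup>+ \<omega>. h \<omega> (\<xi> (Suc j) i \<omega>) \<partial>P)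
    = (\<integral>\<^sup>+ \<omega>. (\<Sum>l=1..N. ennreal (N * (G j (\<xi> j l \<omega>) / weight_sum j \<omega>))
          * (\<integral>\<^sup>+ y. h \<omega> y \<partial>M (Suc j) (\<xi> j l \<omega>))) \<partial>P)"
proof -
  have hs: "h \<omega> \<in> borel_measurable (E (Suc j))" if "\<omega> \<in> space P" for \<omega>
    using measurable_compose[OF measurable_Pair1' h, of \<omega>] that by simp
  have sub: "subalgebra P (past j)" using j by (intro subalgebra_past) simp
  have "(\<Sum>i=1..N. \<integral>\<^sup>+ \<omega>. h \<omega> (\<xi> (Suc j) i \<omega>) \<partial>P)
      = (\<Sum>i=1..N. \<integral>\<^sup>+ \<omega>. (\<integral>\<^sup>+ y. h \<omega> y \<partial>transition_kernel j i \<omega>) \<partial>P)"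
    using j by (intro sum.cong refl nn_integral_cond_kernel[OF prob_space_P sub
          particle_measurable transition_kernel_measurable particle_conditional_law h]) auto
  also have "\<dots> = (\<integral>\<^sup>+ \<omega>. (\<Sum>i=1..N. \<integral>\<^sup>+ y. h \<omega> y \<partial>transition_kernel j i \<omega>) \<partial>P)"
    using j by (intro nn_integral_sum[symmetric] measurable_from_subalg[OF sub]
        nn_integral_measurable_subprob_algebra2[OF h] transition_kernel_measurable) auto
  also have "\<dots> = (\<integral>\<^sup>+ \<omega>. (\<Sum>l=1..N. ennreal (N * (G j (\<xi> j l \<omega>) / weight_sum j \<omega>))
          * (\<integral>\<^sup>+ y. h \<omega> y \<partial>M (Suc j) (\<xi> j l \<omega>))) \<partial>P)"
  proof (rule nn_integral_cong_AE)
    show "AE \<omega> in P. (\<Sum>i=1..N. \<integral>\<^sup>+ y. h \<omega> y \<partial>transition_kernel j i \<omega>)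
        = (\<Sum>l=1..N. ennreal (N * (G j (\<xi> j l \<omega>) / weight_sum j \<omega>))
          * (\<integral>\<^sup>+ y. h \<omega> y \<partial>M (Suc j) (\<xi> j l \<omega>)))"
      using weight_sum_pos[OF j] AE_space
    proof eventually_elim
      case (elim \<omega>)
      let ?I = "\<lambda>l. \<integral>\<^sup>+ y. h \<omega> y \<partial>M (Suc j) (\<xi> j l \<omega>)"
      have "(\<Sum>i=1..N. \<integral>\<^sup>+ y. h \<omega> y \<partial>transition_kernel j i \<omega>)
        = (\<Sum>i=1..N. \<Sum>l=1..N. ennreal (transition_weight j i l \<omega>) * ?I l)"
        by (intro sum.cong refl nn_integral_transition_kernel j elim hs)
      \<comment> \<open>Exchanging the sums groups the terms by the selected position
        \<open>l\<close>, so the column sums apply and remove \<epsilon>.\<close>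
      also have "\<dots> = (\<Sum>l=1..N. (\<Sum>i=1..N. ennreal (transition_weight j i l \<omega>)) * ?I l)"
        by (subst sum.swap) (simp add: sum_distrib_right)
      also have "\<dots> = (\<Sum>l=1..N. ennreal (N * (G j (\<xi> j l \<omega>) / weight_sum j \<omega>)) * ?I l)"
      proof (rule sum.cong[OF refl])
        fix l assume l: "l \<in> {1..N}"
        have "(\<Sum>i=1..N. ennreal (transition_weight j i l \<omega>))
            = ennreal (\<Sum>i=1..N. transition_weight j i l \<omega>)"
          using j l elim by (intro sum_ennreal transition_weight_nonneg) auto
        then show "(\<Sum>i=1..N. ennreal (transition_weight j i l \<omega>)) * ?I l
            = ennreal (N * (G j (\<xi> j l \<omega>) / weight_sum j \<omega>)) * ?I l"
          using sum_transition_weight'[OF l elim(1)] by simp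
      qed
      finally show ?case .
    qed
  qed
  finally show ?thesis .
qed

section \<open>Recursions, measurability and the backward weight\<close>

lemma snell_last: "snell n f G M n = (\<lambda>x. ennreal (f n x))"
  by (simp add: fun_eq_iff snell.simps[of n f G M n])

lemma snell_step:
  "j < n \<Longrightarrow> snell n f G M j x = max (ennreal (f j x))
     (ennreal (G j x) * (\<integral>\<^sup>+ y. snell n f G M (Suc j) y \<partial>M (Suc j) x))"
  by (simp add: snell.simps[of n f G M j])

lemma expected_snell_measurable:
  assumes "j < n" "snell n f G M (Suc j) \<in> borel_measurable (E (Suc j))"
  shows "(\<lambda>x. \<integral>\<^sup>+ y. snell n f G M (Suc j) y \<partial>M (Suc j) x) \<in> borel_measurable (E j)"
  by (rule nn_integral_measurable_subprob_algebra2[OF _ M_subprob[OF assms(1)]]) (use assms(2) in simp)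

lemma snell_measurable: "j \<le> n \<Longrightarrow> snell n f G M j \<in> borel_measurable (E j)"
proof (induction rule: inc_induct)
  case base
  then show ?case using f_measurable[of n] by (simp add: snell_last)
next
  case (step j)
  then show ?case
    using expected_snell_measurable[of j] f_measurable[of j] G_measurable[of j]
    by (simp add: fun_eq_iff snell_step[OF \<open>j < n\<close>, abs_def])
qed

text \<open>The general source \<open>Q\<close> lets one statement serve for fixed or random
  \<open>\<omega>\<close>, base point and target point. Mapping \<open>W\<close> into the past at
  time \<open>j\<close> records that no later particle enters the weight.\<close>

lemma backward_weight_measurable:
  assumes j: "j < n" and W: "W \<in> Q \<rightarrow>\<^sub>M past j"
    and X: "X \<in> Q \<rightarrow>\<^sub>M E j" and Y: "Y \<in> Q \<rightarrow>\<^sub>M E (Suc j)"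
  shows "(\<lambda>q. backward_weight j (W q) (X q) (Y q)) \<in> borel_measurable Q"
proof -
  have [measurable]: "(\<lambda>q. H (Suc j) (Z q) (Y q)) \<in> borel_measurable Q"
      "(\<lambda>q. G j (Z q)) \<in> borel_measurable Q" if "Z \<in> Q \<rightarrow>\<^sub>M E j" for Z
    using measurable_compose[OF measurable_Pair[OF that Y] H_measurable[OF j]]
      measurable_compose[OF that G_measurable] j by simp_all
  have Z: "(\<lambda>q. \<xi> j l (W q)) \<in> Q \<rightarrow>\<^sub>M E j" if "l \<in> {1..N}" for l
    using j that by (intro measurable_compose[OF W particle_measurable_past]) auto
  have "(\<lambda>q. \<Sum>l=1..N. ennreal (G j (\<xi> j l (W q)))) \<in> borel_measurable Q"
      "(\<lambda>q. \<Sum>l=1..N. ennreal (G j (\<xi> j l (W q)) * H (Suc j) (\<xi> j l (W q)) (Y q))) \<in> borel_measurable Q"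
    by (intro borel_measurable_sum measurable_ennreal borel_measurable_times; use Z in measurable)+
  moreover have "(\<lambda>q. ennreal (G j (X q) * H (Suc j) (X q) (Y q))) \<in> borel_measurable Q"
    using X by measurable
  ultimately show ?thesis
    unfolding backward_weight_def
    by (intro borel_measurable_times_ennreal borel_measurable_divide_ennreal) auto
qed

lemma measurable_into_past:
  "j \<le> n \<Longrightarrow> W \<in> Q \<rightarrow>\<^sub>M P \<Longrightarrow> W \<in> Q \<rightarrow>\<^sub>M past j"
  using subalgebra_past[of j] by (auto simp: subalgebra_def measurable_def)

lemma snell_approx_last: "snell_approx n f G H e n x = ennreal (f n x)"
  by (simp add: snell_approx.simps[of n f G H e n])

text \<open>Both empirical integrals become particle sums. Measurability of the next function is a
  hypothesis because it is established by an induction that itself uses this recursion.\<close>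

lemma snell_approx_step:
  assumes j: "j < n" and \<omega>: "\<omega> \<in> space P" and x: "x \<in> space (E j)"
    and next_measurable: "snell_approx n f G H (emp \<omega>) (Suc j) \<in> borel_measurable (E (Suc j))"
  shows "snell_approx n f G H (emp \<omega>) j x = max (ennreal (f j x))
    ((\<Sum>i=1..N. backward_weight j \<omega> x (\<xi> (Suc j) i \<omega>)
        * snell_approx n f G H (emp \<omega>) (Suc j) (\<xi> (Suc j) i \<omega>)) / of_nat N)"
proof -
  let ?v = "snell_approx n f G H (emp \<omega>) (Suc j)"
  have \<xi>: "\<xi> j l \<omega> \<in> space (E j)" "\<xi> (Suc j) l \<omega> \<in> space (E (Suc j))" if "l \<in> {1..N}" for l
    using j that \<omega> by (auto intro!: particle_in_space)
  have "(\<integral>\<^sup>+ y. ennreal (G j x * H (Suc j) x y) * (\<integral>\<^sup>+ z. ennreal (G j z) \<partial>emp \<omega> j)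
          / (\<integral>\<^sup>+ z. ennreal (G j z * H (Suc j) z y) \<partial>emp \<omega> j) * ?v y \<partial>emp \<omega> (Suc j))
      = (\<integral>\<^sup>+ y. backward_weight j \<omega> x y * ?v y \<partial>emp \<omega> (Suc j))"
  proof (rule nn_integral_cong)
    fix y assume "y \<in> space (emp \<omega> (Suc j))"
    then have y: "y \<in> space (E (Suc j))" by simp
    have "(\<lambda>z. H (Suc j) z y) \<in> borel_measurable (E j)"
      using measurable_compose[OF measurable_Pair2' H_measurable[OF j], of y] y by simp
    then have "(\<integral>\<^sup>+ z. ennreal (G j z * H (Suc j) z y) \<partial>emp \<omega> j)
        = (\<Sum>l=1..N. ennreal (G j (\<xi> j l \<omega>) * H (Suc j) (\<xi> j l \<omega>) y)) / of_nat N"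
      using G_measurable[of j] j \<xi>(1) by (intro nn_integral_empirical_measure) auto
    moreover have "(\<integral>\<^sup>+ z. ennreal (G j z) \<partial>emp \<omega> j) = (\<Sum>l=1..N. ennreal (G j (\<xi> j l \<omega>))) / of_nat N"
      using G_measurable[of j] j \<xi>(1) by (intro nn_integral_empirical_measure) auto
    ultimately show "ennreal (G j x * H (Suc j) x y) * (\<integral>\<^sup>+ z. ennreal (G j z) \<partial>emp \<omega> j)
          / (\<integral>\<^sup>+ z. ennreal (G j z * H (Suc j) z y) \<partial>emp \<omega> j) * ?v y
      = backward_weight j \<omega> x y * ?v y"
      by (simp add: backward_weight_def)
  qed
  also have "\<dots> = (\<Sum>i=1..N. backward_weight j \<omega> x (\<xi> (Suc j) i \<omega>) * ?v (\<xi> (Suc j) i \<omega>)) / of_nat N"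
    using \<omega> x j
    by (intro nn_integral_empirical_measure \<xi> borel_measurable_times_ennreal
        next_measurable backward_weight_measurable) auto
  finally show ?thesis
    using j by (simp add: snell_approx.simps[of n f G H _ j])
qed

text \<open>Joint measurability is what allows evaluation at random particles. It is relative to
  \<open>P\<close> and not to the past at time \<open>j\<close>, because the approximation involves
  particles up to time \<open>n\<close>.\<close>

lemma snell_approx_measurable_pair:
  "j \<le> n \<Longrightarrow> (\<lambda>(\<omega>, x). snell_approx n f G H (emp \<omega>) j x) \<in> borel_measurable (P \<Otimes>\<^sub>M E j)"
proof (induction rule: inc_induct)
  case base
  show ?case
    using measurable_compose[OF measurable_snd f_measurable[of n], of P]
    by (simp add: snell_approx_last case_prod_beta)
next
  case (step j)
  let ?Q = "P \<Otimes>\<^sub>M E j"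
  \<comment> \<open>The section of the jointly measurable function at a fixed
    \<open>\<omega>\<close> supplies the hypothesis of \<open>snell_approx_step\<close>.\<close>
  have next_measurable: "snell_approx n f G H (emp \<omega>) (Suc j) \<in> borel_measurable (E (Suc j))"
    if "\<omega> \<in> space P" for \<omega>
    using measurable_compose[OF measurable_Pair1' step.IH, of \<omega>] that by simp
  have \<xi>: "(\<lambda>q. \<xi> (Suc j) i (fst q)) \<in> ?Q \<rightarrow>\<^sub>M E (Suc j)" if "i \<in> {1..N}" for i
    using step.hyps that by (intro measurable_compose[OF measurable_fst particle_measurable]) auto
  have "(\<lambda>q. snell_approx n f G H (emp (fst q)) (Suc j) (\<xi> (Suc j) i (fst q))) \<in> borel_measurable ?Q"
    if "i \<in> {1..N}" for i
    using measurable_compose[OF measurable_Pair[OF measurable_fst \<xi>[OF that]] step.IH] by simp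
  moreover have "(\<lambda>q. backward_weight j (fst q) (snd q) (\<xi> (Suc j) i (fst q))) \<in> borel_measurable ?Q"
    if "i \<in> {1..N}" for i
    using step.hyps that by (intro backward_weight_measurable measurable_into_past \<xi>) auto
  moreover have "(\<lambda>q. ennreal (f j (snd q))) \<in> borel_measurable ?Q"
    using measurable_compose[OF measurable_snd f_measurable[of j], of P] step.hyps by simp
  ultimately have "(\<lambda>q. max (ennreal (f j (snd q)))
      ((\<Sum>i=1..N. backward_weight j (fst q) (snd q) (\<xi> (Suc j) i (fst q))
        * snell_approx n f G H (emp (fst q)) (Suc j) (\<xi> (Suc j) i (fst q))) / of_nat N))
      \<in> borel_measurable ?Q"
    by (intro borel_measurable_max borel_measurable_divide_ennreal borel_measurable_sum
        borel_measurable_times_ennreal) auto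
  then show ?case
    by (rule measurable_cong[THEN iffD1, rotated])
       (use step.hyps in \<open>auto simp del: One_nat_def simp: space_pair_measure
         intro!: snell_approx_step[symmetric] next_measurable\<close>)
qed

lemma snell_approx_measurable:
  assumes "j \<le> n" "W \<in> Q \<rightarrow>\<^sub>M P" "X \<in> Q \<rightarrow>\<^sub>M E j"
  shows "(\<lambda>q. snell_approx n f G H (emp (W q)) j (X q)) \<in> borel_measurable Q"
  using measurable_compose[OF measurable_Pair[OF assms(2,3)] snell_approx_measurable_pair[OF assms(1)]]
  by simp

text \<open>The backward weight is \<open>G(x)\<close> times the density of \<open>M(x, \<sqdot>)\<close> with respect to the mean law of
  the next particles.\<close>

lemma nn_integral_backward_weight:
  assumes j: "j < n" and \<omega>: "\<omega> \<in> space P" and x: "x \<in> space (E j)" and pos: "0 < weight_sum j \<omega>"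
    and v[measurable]: "v \<in> borel_measurable (E (Suc j))"
  shows "(\<Sum>l=1..N. ennreal (G j (\<xi> j l \<omega>) / weight_sum j \<omega>)
        * (\<integral>\<^sup>+ y. backward_weight j \<omega> x y * v y \<partial>M (Suc j) (\<xi> j l \<omega>)))
    = ennreal (G j x) * (\<integral>\<^sup>+ y. v y \<partial>M (Suc j) x)"
proof -
  let ?S = "weight_sum j \<omega>" and ?L = "lam (Suc j)"
  have \<xi>: "\<xi> j l \<omega> \<in> space (E j)" if "l \<in> {1..N}" for l
    using j that \<omega> by (auto intro!: particle_in_space)
  have [measurable_cong]: "sets ?L = sets (E (Suc j))" by (rule reference[OF j])
  have [simp]: "space ?L = space (E (Suc j))" by (rule sets_eq_imp_space_eq[OF reference[OF j]])
  have H[measurable]: "(\<lambda>y. H (Suc j) z y) \<in> borel_measurable (E (Suc j))" if "z \<in> space (E j)" for z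
    using measurable_compose[OF measurable_Pair1' H_measurable[OF j], of z] that by simp
  have b[measurable]: "backward_weight j \<omega> x \<in> borel_measurable (E (Suc j))"
    using \<omega> x j by (intro backward_weight_measurable) auto
  have G0: "0 \<le> G j (\<xi> j l \<omega>)" if "l \<in> {1..N}" for l
    using j \<xi>[OF that] by (intro G_nonneg) auto
  \<comment> \<open>All mixture components and the target law are written over the common reference
    measure, so the claim becomes a pointwise identity of densities.\<close>
  have dens: "(\<integral>\<^sup>+ y. g y \<partial>M (Suc j) z) = (\<integral>\<^sup>+ y. ennreal (H (Suc j) z y) * g y \<partial>?L)"
    if "z \<in> space (E j)" and [measurable]: "g \<in> borel_measurable (E (Suc j))" for z g
    using H[OF that(1)] unfolding M_density[OF j that(1)] by (intro nn_integral_density) auto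
  have "(\<Sum>l=1..N. ennreal (G j (\<xi> j l \<omega>) / ?S)
        * (\<integral>\<^sup>+ y. backward_weight j \<omega> x y * v y \<partial>M (Suc j) (\<xi> j l \<omega>)))
    = (\<Sum>l=1..N. \<integral>\<^sup>+ y. ennreal (G j (\<xi> j l \<omega>) / ?S)
        * (ennreal (H (Suc j) (\<xi> j l \<omega>) y) * (backward_weight j \<omega> x y * v y)) \<partial>?L)"
  proof (rule sum.cong[OF refl])
    fix l assume l: "l \<in> {1..N}"
    note [measurable] = H[OF \<xi>[OF l]]
    show "ennreal (G j (\<xi> j l \<omega>) / ?S)
        * (\<integral>\<^sup>+ y. backward_weight j \<omega> x y * v y \<partial>M (Suc j) (\<xi> j l \<omega>))
      = (\<integral>\<^sup>+ y. ennreal (G j (\<xi> j l \<omega>) / ?S)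
        * (ennreal (H (Suc j) (\<xi> j l \<omega>) y) * (backward_weight j \<omega> x y * v y)) \<partial>?L)"
      by (subst dens[OF \<xi>[OF l]], simp, subst nn_integral_cmult) auto
  qed
  also have "\<dots> = (\<integral>\<^sup>+ y. (\<Sum>l=1..N. ennreal (G j (\<xi> j l \<omega>) / ?S)
        * (ennreal (H (Suc j) (\<xi> j l \<omega>) y) * (backward_weight j \<omega> x y * v y))) \<partial>?L)"
  proof (rule nn_integral_sum[symmetric])
    fix l assume l: "l \<in> {1..N}"
    note [measurable] = H[OF \<xi>[OF l]]
    show "(\<lambda>y. ennreal (G j (\<xi> j l \<omega>) / ?S)
        * (ennreal (H (Suc j) (\<xi> j l \<omega>) y) * (backward_weight j \<omega> x y * v y))) \<in> borel_measurable ?L"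
      by measurable
  qed
  also have "\<dots> = (\<integral>\<^sup>+ y. ennreal (G j x) * (ennreal (H (Suc j) x y) * v y) \<partial>?L)"
  proof (rule nn_integral_cong)
    fix y assume "y \<in> space ?L"
    then have y: "y \<in> space (E (Suc j))" by simp
    \<comment> \<open>The mixture has density \<open>T / ?S\<close> at \<open>y\<close>, and the
      backward weight is \<open>G j x * H (Suc j) x y * ?S / T\<close>; their product leaves
      \<open>G j x * H (Suc j) x y\<close>.\<close>
    define T where "T = (\<Sum>l=1..N. G j (\<xi> j l \<omega>) * H (Suc j) (\<xi> j l \<omega>) y)"
    have Hpos: "0 < H (Suc j) z y" if "z \<in> space (E j)" for z using H_pos j that y by blast
    have GH: "0 \<le> G j (\<xi> j l \<omega>) * H (Suc j) (\<xi> j l \<omega>) y" if "l \<in> {1..N}" for l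
      using G0[OF that] Hpos[OF \<xi>[OF that]] by simp
    \<comment> \<open>A positive weight sum forces one positive \<open>G\<close>; strict positivity
      of \<open>H\<close> then makes \<open>T\<close> positive, so the division is genuine.\<close>
    have "\<exists>l\<in>{1..N}. 0 < G j (\<xi> j l \<omega>)"
      using pos sum_nonpos[of "{1..N}" "\<lambda>l. G j (\<xi> j l \<omega>)"] unfolding weight_sum_def
      by (meson not_less)
    then have T: "0 < T"
      unfolding T_def using GH Hpos \<xi> by (auto intro!: sum_pos2)
    have T_sum: "(\<Sum>l=1..N. ennreal (G j (\<xi> j l \<omega>) * H (Suc j) (\<xi> j l \<omega>) y)) = ennreal T"
      unfolding T_def by (rule sum_ennreal) (rule GH)
    have S_sum: "(\<Sum>l=1..N. ennreal (G j (\<xi> j l \<omega>))) = ennreal ?S"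
      unfolding weight_sum_def by (rule sum_ennreal) (rule G0)
    have Nn: "0 < real N" using N by simp
    have GHx: "0 \<le> G j x * H (Suc j) x y"
      using G_nonneg[of j x] j x Hpos[OF x] by simp
    have "backward_weight j \<omega> x y = ennreal (G j x * H (Suc j) x y * (?S / N) / (T / N))"
      using T pos Nn GHx unfolding backward_weight_def T_sum S_sum
      by (simp add: ennreal_of_nat_eq_real_of_nat divide_ennreal ennreal_mult[symmetric])
    then have bw: "backward_weight j \<omega> x y = ennreal (G j x * H (Suc j) x y * ?S / T)"
      using Nn by (simp add: field_simps)
    have "(\<Sum>l=1..N. ennreal (G j (\<xi> j l \<omega>) / ?S)
        * (ennreal (H (Suc j) (\<xi> j l \<omega>) y) * (backward_weight j \<omega> x y * v y)))
      = (\<Sum>l=1..N. ennreal (G j (\<xi> j l \<omega>) * H (Suc j) (\<xi> j l \<omega>) y / ?S))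
        * (backward_weight j \<omega> x y * v y)"
      unfolding sum_distrib_right
    proof (rule sum.cong[OF refl])
      fix l assume l: "l \<in> {1..N}"
      have "ennreal (G j (\<xi> j l \<omega>) * H (Suc j) (\<xi> j l \<omega>) y / ?S)
        = ennreal (G j (\<xi> j l \<omega>) / ?S) * ennreal (H (Suc j) (\<xi> j l \<omega>) y)"
        using G0[OF l] pos Hpos[OF \<xi>[OF l]] by (subst ennreal_mult[symmetric]) auto
      then show "ennreal (G j (\<xi> j l \<omega>) / ?S)
          * (ennreal (H (Suc j) (\<xi> j l \<omega>) y) * (backward_weight j \<omega> x y * v y))
        = ennreal (G j (\<xi> j l \<omega>) * H (Suc j) (\<xi> j l \<omega>) y / ?S) * (backward_weight j \<omega> x y * v y)"
        by (simp add: mult.assoc)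
    qed
    also have "(\<Sum>l=1..N. ennreal (G j (\<xi> j l \<omega>) * H (Suc j) (\<xi> j l \<omega>) y / ?S)) = ennreal (T / ?S)"
      unfolding T_def sum_divide_distrib using GH pos by (intro sum_ennreal divide_nonneg_pos) auto
    also have "ennreal (T / ?S) * (backward_weight j \<omega> x y * v y)
        = ennreal ((T / ?S) * (G j x * H (Suc j) x y * ?S / T)) * v y"
      unfolding bw ennreal_mult[OF less_imp_le[OF divide_pos_pos[OF T pos]]
          divide_nonneg_pos[OF mult_nonneg_nonneg[OF GHx less_imp_le[OF pos]] T]]
      by (simp add: mult.assoc)
    also have "(T / ?S) * (G j x * H (Suc j) x y * ?S / T) = G j x * H (Suc j) x y"
      using T pos by simp
    also have "ennreal (G j x * H (Suc j) x y) * v y = ennreal (G j x) * (ennreal (H (Suc j) x y) * v y)"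
      using G_nonneg[of j x] j x Hpos[OF x] by (subst ennreal_mult) (auto simp: mult.assoc)
    finally show "(\<Sum>l=1..N. ennreal (G j (\<xi> j l \<omega>) / ?S)
        * (ennreal (H (Suc j) (\<xi> j l \<omega>) y) * (backward_weight j \<omega> x y * v y)))
      = ennreal (G j x) * (ennreal (H (Suc j) x y) * v y)" .
  qed
  also have "\<dots> = ennreal (G j x) * (\<integral>\<^sup>+ y. v y \<partial>M (Suc j) x)"
    unfolding dens[OF x v] using H[OF x] v reference[OF j]
    by (intro nn_integral_cmult) (simp cong: measurable_cong_sets)
  finally show ?thesis .
qed

section \<open>Backward induction on weighted expectations\<close>

text \<open>The weight \<open>\<phi>\<close> is what makes the induction close: it absorbs the
  backward weights and the event on which continuing is optimal, both known by the time the next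
  function is evaluated.\<close>

lemma snell_le_snell_approx_weighted:
  assumes "j \<le> n"
    and "\<phi> \<in> borel_measurable (past j)" and "Y \<in> past j \<rightarrow>\<^sub>M E j"
  shows "(\<integral>\<^sup>+ \<omega>. \<phi> \<omega> * snell n f G M j (Y \<omega>) \<partial>P)
    \<le> (\<integral>\<^sup>+ \<omega>. \<phi> \<omega> * snell_approx n f G H (emp \<omega>) j (Y \<omega>) \<partial>P)"
  using assms
proof (induction arbitrary: \<phi> Y rule: inc_induct)
  case base
  then show ?case by (simp add: snell_last snell_approx_last)
next
  case (step j \<phi> Y)
  note j = \<open>j < n\<close>
  let ?v = "snell n f G M" and ?w = "\<lambda>\<omega>. snell_approx n f G H (emp \<omega>)"
  have subs: "subalgebra P (past j)" "subalgebra P (past (Suc j))"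
    using j by (auto intro!: subalgebra_past)
  have \<phi>: "\<phi> \<in> borel_measurable (past j)" and Y: "Y \<in> past j \<rightarrow>\<^sub>M E j"
    using step.prems by auto
  have Y_space: "Y \<omega> \<in> space (E j)" if "\<omega> \<in> space P" for \<omega>
    using measurable_space[OF Y] that by simp
  have v_next: "?v (Suc j) \<in> borel_measurable (E (Suc j))"
    using j by (intro snell_measurable) simp
  define a where "a \<omega> = ennreal (f j (Y \<omega>))" for \<omega>
  define b where "b \<omega> = ennreal (G j (Y \<omega>)) * (\<integral>\<^sup>+ y. ?v (Suc j) y \<partial>M (Suc j) (Y \<omega>))" for \<omega>
  have a: "a \<in> borel_measurable (past j)"
    using measurable_compose[OF Y f_measurable[of j]] j by (simp add: a_def[abs_def])
  have b: "b \<in> borel_measurable (past j)"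
    using measurable_compose[OF Y G_measurable[of j]] j
      measurable_compose[OF Y expected_snell_measurable[OF j v_next]] by (simp add: b_def[abs_def])
  \<comment> \<open>\<open>a\<close> and \<open>b\<close> are the stopping and continuation
    branches. \<open>\<theta>\<close> collects the stopping gain on
    \<open>b \<omega> \<le> a \<omega>\<close> and \<open>\<psi>\<close> is the weight left for
    continuing, so that \<open>\<phi>\<close> times the envelope is
    \<open>\<theta> + \<psi> * b\<close>.\<close>
  define \<psi> where "\<psi> \<omega> = (if b \<omega> \<le> a \<omega> then 0 else \<phi> \<omega>)" for \<omega>
  define \<theta> where "\<theta> \<omega> = (if b \<omega> \<le> a \<omega> then \<phi> \<omega> * a \<omega> else 0)" for \<omega>
  have \<psi>: "\<psi> \<in> borel_measurable (past j)" and \<theta>: "\<theta> \<in> borel_measurable (past j)"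
    using a b \<phi> unfolding \<psi>_def[abs_def] \<theta>_def[abs_def] by measurable
  let ?r = "\<lambda>i \<omega>. backward_weight j \<omega> (Y \<omega>) (\<xi> (Suc j) i \<omega>)"
  \<comment> \<open>Dividing by \<open>N\<close> compensates the factor \<open>N\<close> in
    \<open>nn_integral_next_particles\<close>, so summing \<open>h\<close> over the next particles
    yields their average.\<close>
  define h where "h \<omega> y = \<psi> \<omega> / of_nat N * (backward_weight j \<omega> (Y \<omega>) y * ?v (Suc j) y)" for \<omega> y
  have h: "case_prod h \<in> borel_measurable (past j \<Otimes>\<^sub>M E (Suc j))"
    unfolding h_def[abs_def] case_prod_beta'
    by (intro borel_measurable_times_ennreal borel_measurable_divide_ennreal
        measurable_compose[OF measurable_fst \<psi>] measurable_compose[OF measurable_snd v_next]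
        backward_weight_measurable[OF j] measurable_compose[OF measurable_fst Y]
        measurable_fst measurable_snd measurable_const) simp
  have \<xi>: "\<xi> (Suc j) i \<in> past (Suc j) \<rightarrow>\<^sub>M E (Suc j)" if "i \<in> {1..N}" for i
    using j that by (intro particle_measurable_past) auto
  \<comment> \<open>This is the weight for the induction hypothesis. It involves particle
    \<open>i\<close> at time \<open>Suc j\<close>, hence is measurable only one step later than
    \<open>\<psi>\<close>.\<close>
  have \<psi>r: "(\<lambda>\<omega>. \<psi> \<omega> / of_nat N * ?r i \<omega>) \<in> borel_measurable (past (Suc j))" if "i \<in> {1..N}" for i
    by (intro borel_measurable_times_ennreal borel_measurable_divide_ennreal
        backward_weight_measurable[OF j] \<xi>[OF that] measurable_past_mono[of j "Suc j"]
        \<psi> Y measurable_ident_sets measurable_const) simp_all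
  have w: "(\<lambda>\<omega>. ?w \<omega> (Suc j) (\<xi> (Suc j) i \<omega>)) \<in> borel_measurable P" if "i \<in> {1..N}" for i
    using j that by (intro snell_approx_measurable particle_measurable) auto
  have w_next: "?w \<omega> (Suc j) \<in> borel_measurable (E (Suc j))" if "\<omega> \<in> space P" for \<omega>
    using j that by (intro snell_approx_measurable) auto
  have next_term: "(\<lambda>\<omega>. \<psi> \<omega> / of_nat N * ?r i \<omega> * ?w \<omega> (Suc j) (\<xi> (Suc j) i \<omega>)) \<in> borel_measurable P"
    if "i \<in> {1..N}" for i
    using that by (intro borel_measurable_times_ennreal w measurable_from_subalg[OF subs(2) \<psi>r]) auto
  have "(\<integral>\<^sup>+ \<omega>. \<phi> \<omega> * ?v j (Y \<omega>) \<partial>P) = (\<integral>\<^sup>+ \<omega>. \<theta> \<omega> + \<psi> \<omega> * b \<omega> \<partial>P)"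
    by (intro nn_integral_cong)
       (auto simp: snell_step[OF j] \<theta>_def \<psi>_def a_def b_def max_def)
  also have "\<dots> = (\<integral>\<^sup>+ \<omega>. \<theta> \<omega> \<partial>P) + (\<integral>\<^sup>+ \<omega>. \<psi> \<omega> * b \<omega> \<partial>P)"
    by (intro nn_integral_add borel_measurable_times_ennreal measurable_from_subalg[OF subs(1)] \<theta> \<psi> b)
  \<comment> \<open>The continuation value is expressed as a mixture over the current positions by
    \<open>nn_integral_backward_weight\<close>, which requires a positive weight sum and so holds
    almost surely.\<close>
  also have "(\<integral>\<^sup>+ \<omega>. \<psi> \<omega> * b \<omega> \<partial>P)
    = (\<integral>\<^sup>+ \<omega>. (\<Sum>l=1..N. ennreal (N * (G j (\<xi> j l \<omega>) / weight_sum j \<omega>))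
          * (\<integral>\<^sup>+ y. h \<omega> y \<partial>M (Suc j) (\<xi> j l \<omega>))) \<partial>P)"
  proof (rule nn_integral_cong_AE)
    show "AE \<omega> in P. \<psi> \<omega> * b \<omega> = (\<Sum>l=1..N. ennreal (N * (G j (\<xi> j l \<omega>) / weight_sum j \<omega>))
          * (\<integral>\<^sup>+ y. h \<omega> y \<partial>M (Suc j) (\<xi> j l \<omega>)))"
      using weight_sum_pos[OF j] AE_space
    proof eventually_elim
      case (elim \<omega>)
      let ?g = "\<lambda>y. backward_weight j \<omega> (Y \<omega>) y * ?v (Suc j) y"
      have g: "?g \<in> borel_measurable (E (Suc j))"
        using elim(2) Y_space[OF elim(2)] by (intro borel_measurable_times_ennreal v_next
            backward_weight_measurable[OF j]) auto
      have "ennreal (N * (G j (\<xi> j l \<omega>) / weight_sum j \<omega>)) * (\<integral>\<^sup>+ y. h \<omega> y \<partial>M (Suc j) (\<xi> j l \<omega>))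
        = \<psi> \<omega> * (ennreal (G j (\<xi> j l \<omega>) / weight_sum j \<omega>)
            * (\<integral>\<^sup>+ y. ?g y \<partial>M (Suc j) (\<xi> j l \<omega>)))" if l: "l \<in> {1..N}" for l
      proof -
        have "sets (M (Suc j) (\<xi> j l \<omega>)) = sets (E (Suc j))"
          using M_particle_subprob[OF j l elim(2)] by (simp add: space_subprob_algebra)
        then have "?g \<in> borel_measurable (M (Suc j) (\<xi> j l \<omega>))"
          using g by (simp cong: measurable_cong_sets)
        then have I: "(\<integral>\<^sup>+ y. h \<omega> y \<partial>M (Suc j) (\<xi> j l \<omega>))
            = \<psi> \<omega> / of_nat N * (\<integral>\<^sup>+ y. ?g y \<partial>M (Suc j) (\<xi> j l \<omega>))"
          unfolding h_def by (rule nn_integral_cmult)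
        have "0 \<le> G j (\<xi> j l \<omega>) / weight_sum j \<omega>"
          using j l elim by (intro divide_nonneg_pos G_nonneg particle_in_space) auto
        then have c: "ennreal (N * (G j (\<xi> j l \<omega>) / weight_sum j \<omega>))
            = of_nat N * ennreal (G j (\<xi> j l \<omega>) / weight_sum j \<omega>)"
          by (subst ennreal_mult) (auto simp: ennreal_of_nat_eq_real_of_nat)
        have \<psi>_N: "of_nat N * (\<psi> \<omega> / of_nat N) = \<psi> \<omega>"
          using N mult_divide_eq_ennreal[of "of_nat N" "\<psi> \<omega>"]
          by (simp add: ennreal_times_divide mult.commute)
        have "of_nat N * u * (\<psi> \<omega> / of_nat N * J) = of_nat N * (\<psi> \<omega> / of_nat N) * (u * J)" for u J
          by (simp only: ac_simps)
        then show ?thesis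
          unfolding c I \<psi>_N .
      qed
      then have "(\<Sum>l=1..N. ennreal (N * (G j (\<xi> j l \<omega>) / weight_sum j \<omega>))
          * (\<integral>\<^sup>+ y. h \<omega> y \<partial>M (Suc j) (\<xi> j l \<omega>)))
        = \<psi> \<omega> * (\<Sum>l=1..N. ennreal (G j (\<xi> j l \<omega>) / weight_sum j \<omega>)
            * (\<integral>\<^sup>+ y. ?g y \<partial>M (Suc j) (\<xi> j l \<omega>)))"
        unfolding sum_distrib_left by (intro sum.cong refl) auto
      also have "\<dots> = \<psi> \<omega> * b \<omega>"
        unfolding b_def
        by (subst nn_integral_backward_weight[OF j elim(2) Y_space[OF elim(2)] elim(1) v_next]) simp
      finally show ?case by simp
    qed
  qed
  also have "\<dots> = (\<Sum>i=1..N. \<integral>\<^sup>+ \<omega>. h \<omega> (\<xi> (Suc j) i \<omega>) \<partial>P)"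
    by (rule nn_integral_next_particles[OF j h, symmetric])
  also have "\<dots> = (\<Sum>i=1..N. \<integral>\<^sup>+ \<omega>. \<psi> \<omega> / of_nat N * ?r i \<omega> * ?v (Suc j) (\<xi> (Suc j) i \<omega>) \<partial>P)"
    by (simp add: h_def mult.assoc)
  \<comment> \<open>The induction hypothesis is applied for each \<open>i\<close> with the weight
    from \<open>\<psi>r\<close> and the random point \<open>\<xi> (Suc j) i\<close>.\<close>
  also have "(\<integral>\<^sup>+ \<omega>. \<theta> \<omega> \<partial>P) + \<dots>
    \<le> (\<integral>\<^sup>+ \<omega>. \<theta> \<omega> \<partial>P)
      + (\<Sum>i=1..N. \<integral>\<^sup>+ \<omega>. \<psi> \<omega> / of_nat N * ?r i \<omega> * ?w \<omega> (Suc j) (\<xi> (Suc j) i \<omega>) \<partial>P)"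
    by (intro add_left_mono sum_mono step.IH \<psi>r \<xi>)
  also have "\<dots> = (\<integral>\<^sup>+ \<omega>. \<theta> \<omega> + (\<Sum>i=1..N. \<psi> \<omega> / of_nat N * ?r i \<omega> * ?w \<omega> (Suc j) (\<xi> (Suc j) i \<omega>)) \<partial>P)"
    using measurable_from_subalg[OF subs(1) \<theta>] next_term
    by (subst nn_integral_add)
       (auto intro!: borel_measurable_sum nn_integral_sum[symmetric] simp del: One_nat_def)
  \<comment> \<open>The branch chosen by comparing \<open>a\<close> and \<open>b\<close> need not be
    the larger one for the approximation, but the maximum dominates either branch.\<close>
  also have "\<dots> \<le> (\<integral>\<^sup>+ \<omega>. \<phi> \<omega> * ?w \<omega> j (Y \<omega>) \<partial>P)"
  proof (rule nn_integral_mono)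
    fix \<omega> assume \<omega>: "\<omega> \<in> space P"
    let ?s = "(\<Sum>i=1..N. ?r i \<omega> * ?w \<omega> (Suc j) (\<xi> (Suc j) i \<omega>)) / of_nat N"
    have "(\<Sum>i=1..N. \<psi> \<omega> / of_nat N * ?r i \<omega> * ?w \<omega> (Suc j) (\<xi> (Suc j) i \<omega>)) = \<psi> \<omega> * ?s"
      by (simp add: divide_ennreal_def sum_distrib_left sum_distrib_right ac_simps)
    moreover have "?w \<omega> j (Y \<omega>) = max (a \<omega>) ?s"
      unfolding a_def by (rule snell_approx_step[OF j \<omega> Y_space[OF \<omega>] w_next[OF \<omega>]])
    ultimately show "\<theta> \<omega> + (\<Sum>i=1..N. \<psi> \<omega> / of_nat N * ?r i \<omega> * ?w \<omega> (Suc j) (\<xi> (Suc j) i \<omega>))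
        \<le> \<phi> \<omega> * ?w \<omega> j (Y \<omega>)"
      by (auto simp: \<theta>_def \<psi>_def intro!: mult_left_mono)
  qed
  finally show ?case .
qed

end

theorem proposition4p4:
  fixes n N :: nat
    and E lam :: "nat \<Rightarrow> 'a measure"
    and \<eta>0 :: "'a measure"
    and M :: "nat \<Rightarrow> 'a \<Rightarrow> 'a measure"
    and H :: "nat \<Rightarrow> 'a \<Rightarrow> 'a \<Rightarrow> real"
    and f G :: "nat \<Rightarrow> 'a \<Rightarrow> real"
    and \<epsilon> :: real
    and P :: "'w measure"
    and \<xi> :: "nat \<Rightarrow> nat \<Rightarrow> 'w \<Rightarrow> 'a"
    and \<eta> :: "'w \<Rightarrow> nat \<Rightarrow> 'a measure"
    and k :: nat and x :: 'a
  defines "\<eta> \<equiv> \<lambda>\<omega> j. empirical_measure N (E j) (\<lambda>i. \<xi> j i \<omega>)"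
  assumes n: "n \<ge> 1"
    and N: "N \<ge> 1"
    and initial: "prob_space \<eta>0" "sets \<eta>0 = sets (E 0)"
    and markov: "\<And>j. j < n \<Longrightarrow> M (Suc j) \<in> E j \<rightarrow>\<^sub>M prob_algebra (E (Suc j))"
    and reference: "\<And>j. j < n \<Longrightarrow> sets (lam (Suc j)) = sets (E (Suc j))"
    and H_measurable:
      "\<And>j. j < n \<Longrightarrow> case_prod (H (Suc j)) \<in> borel_measurable (E j \<Otimes>\<^sub>M E (Suc j))"
    and H_pos:
      "\<And>j y z. j < n \<Longrightarrow> y \<in> space (E j) \<Longrightarrow> z \<in> space (E (Suc j)) \<Longrightarrow> 0 < H (Suc j) y z"
    and M_density:
      "\<And>j y. j < n \<Longrightarrow> y \<in> space (E j) \<Longrightarrow>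
         M (Suc j) y = density (lam (Suc j)) (\<lambda>z. ennreal (H (Suc j) y z))"
    and f_measurable: "\<And>j. j \<le> n \<Longrightarrow> f j \<in> borel_measurable (E j)"
    and f_nonneg: "\<And>j y. j \<le> n \<Longrightarrow> y \<in> space (E j) \<Longrightarrow> 0 \<le> f j y"
    and G_measurable: "\<And>j. j \<le> n \<Longrightarrow> G j \<in> borel_measurable (E j)"
    and G_nonneg: "\<And>j y. j \<le> n \<Longrightarrow> y \<in> space (E j) \<Longrightarrow> 0 \<le> G j y"
    and G_bounded: "\<And>j. j \<le> n \<Longrightarrow> \<exists>C. \<forall>y\<in>space (E j). G j y \<le> C"
    and snell_finite: "\<And>j y. j \<le> n \<Longrightarrow> y \<in> space (E j) \<Longrightarrow> snell n f G M j y < \<infinity>"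
    and eps_nonneg: "0 \<le> \<epsilon>"
    and eps_G: "\<And>j y. j \<le> n \<Longrightarrow> y \<in> space (E j) \<Longrightarrow> \<epsilon> * G j y \<in> {0..1}"
    and particles: "particle_system P n N \<epsilon> E \<eta>0 M G \<xi>"
    and well_defined: "\<And>j. j < n \<Longrightarrow> AE \<omega> in P. 0 < (\<integral>\<^sup>+ y. ennreal (G j y) \<partial>\<eta> \<omega> j)"
    and k: "k \<le> n"
    and x: "x \<in> space (E k)"
  shows "(\<integral>\<^sup>+ \<omega>. snell_approx n f G H (\<eta> \<omega>) k x \<partial>P) \<ge> snell n f G M k x"
proof -
  interpret particle_model n N E lam \<eta>0 M H f G \<epsilon> P \<xi>
  proof unfold_locales
  qed (fact N markov reference H_measurable H_pos M_density f_measurable G_measurable G_nonneg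
      eps_G particles well_defined[unfolded \<eta>_def])+
  \<comment> \<open>The weighted inequality is used with weight 1 and the constant point
    \<open>x\<close>; as \<open>P\<close> has mass 1, the deterministic envelope equals its own
    expectation.\<close>
  have "snell n f G M k x = (\<integral>\<^sup>+ \<omega>. 1 * snell n f G M k x \<partial>P)"
    using prob_space.emeasure_space_1[OF prob_space_P] by simp
  also have "\<dots> \<le> (\<integral>\<^sup>+ \<omega>. 1 * snell_approx n f G H (emp \<omega>) k x \<partial>P)"
    using k x by (intro snell_le_snell_approx_weighted) auto
  finally show ?thesis
    by (simp add: \<eta>_def)
qed

end
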